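(* Let $d\ge1$ be an integer, $0<s<d$, $N\ge1$. Let $\Gamma$ be a truncated grand-canonical probability with sectors at most $N$, with particle-number random variable $K$ and one-body density $\rho_\Gamma$, such that $$0<\mathbb E K<N,\qquad \operatorname{Var}(K)>0,\qquad 0<\mathcal L(\rho_\Gamma)<\infty .$$ Then $$\frac{\mathcal G(\Gamma)}{\mathcal L(\rho_\Gamma)}<\Lambda_N .$$
   Context: Set $p:=1+s/d$, $\mathcal L(\rho):=\int_{\mathbb R^d}\rho^p$ and $D(\rho):=\iint_{\mathbb R^d\times\mathbb R^d}\rho(x)\rho(y)|x-y|^{-s}\,\mathrm dx\,\mathrm dy$. Fixed-$N$ constant. Let $\mathcal A_N:=\{\rho\in L^1(\mathbb R^d)\cap L^p(\mathbb R^d):\rho\ge0,\ \int\rho=N\}$. For a symmetric probability measure $P$ on $(\mathbb R^d)^N$ let $\rho_P:=\sum_{i=1}^N(\pi_i)_\#P$ ($\pi_i$ the $i$-th coordinate projection; identified with its density when absolutely continuous). For $\rho\in\mathcal A_N$ let $\mathcal W_N(\rho)$ be the minimum of $\int\sum_{1\le i<j\le N}|x_i-x_j|^{-s}\,\mathrm dP$ over symmetric probability measures $P$ on $(\mathbb R^d)^N$ with $\rho_P=\rho$, let $\mathcal G_N(\rho):=\frac12D(\rho)-\mathcal W_N(\rho)$, and $\Lambda_N:=\sup_{\rho\in\mathcal A_N}\mathcal G_N(\rho)/\mathcal L(\rho)$. Truncated grand-canonical probabilities. A truncated grand-canonical probability with sectors at most $N$ is a tuple $\Gamma=(\Gamma^{(0)},\Gamma^{(1)},\dots,\Gamma^{(N)})$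 where $\Gamma^{(0)}\ge0$ is a scalar, each $\Gamma^{(k)}$, $k\ge1$, is a finite symmetric nonnegative measure on $(\mathbb R^d)^k$ with total mass $\|\Gamma^{(k)}\|$, and $\Gamma^{(0)}+\sum_{k=1}^N\|\Gamma^{(k)}\|=1$. Its particle number $K$ is the random variable with $\mathbb P(K=0)=\Gamma^{(0)}$ and $\mathbb P(K=k)=\|\Gamma^{(k)}\|$ for $1\le k\le N$. Put $\rho_k:=\sum_{i=1}^k(\pi_i)_\#\Gamma^{(k)}$ for $k\ge1$, $\rho_0:=0$, and $\rho_\Gamma:=\sum_{k=1}^N\rho_k$ (so $\int\rho_\Gamma=\mathbb E K$). Define $$\mathcal W(\Gamma):=\sum_{k=2}^N\int_{(\mathbb R^d)^k}\sum_{1\le i<j\le k}\frac1{|x_i-x_j|^s}\,\mathrm d\Gamma^{(k)},\qquad \mathcal G(\Gamma):=\tfrac12D(\rho_\Gamma)-\mathcal W(\Gamma).$$ Standing assumption: only grand-canonical probabilities for which $\rho_\Gamma$ is (absolutely continuous with density) in $L^1\cap L^p$ and $D(\rho_\Gamma)$, $\mathcal W(\Gamma)$ are finite are considered. *)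

theory Defs
  imports "HOL-Probability.Probability" "HOL-Combinatorics.Permutations"
begin

text \<open>
  The space \<open>\<real>\<^sup>d\<close> is a Euclidean space type \<open>'a\<close> with \<open>d = DIM('a)\<close>. Configurations of \<open>k\<close>
  particles are points of the product space over the index set \<open>{..<k}\<close>, so that \<open>k\<close> may vary.
  Energies take values in \<open>ennreal\<close>; differences and quotients of energies are formed in \<open>ereal\<close>.
\<close>

text \<open>In \<open>ennreal\<close>, \<open>1 / 0 = \<infinity>\<close>, so coinciding particles have infinite interaction. This matters:
  a measure charging the diagonal may well have an absolutely continuous one-body density.\<close>

definition riesz :: "real \<Rightarrow> 'a::euclidean_space \<Rightarrow> 'a \<Rightarrow> ennreal" where
  "riesz s x y = 1 / ennreal (norm (x - y) powr s)"

definition L_fun :: "real \<Rightarrow> ('a::euclidean_space \<Rightarrow> real) \<Rightarrow> ennreal" where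
  "L_fun s \<rho> = (\<integral>\<^sup>+x. ennreal (\<rho> x powr (1 + s / real DIM('a))) \<partial>lborel)"

definition D_fun :: "real \<Rightarrow> ('a::euclidean_space \<Rightarrow> real) \<Rightarrow> ennreal" where
  "D_fun s \<rho> = (\<integral>\<^sup>+x. \<integral>\<^sup>+y. ennreal (\<rho> x) * ennreal (\<rho> y) * riesz s x y \<partial>lborel \<partial>lborel)"

text \<open>Nonnegative elements of \<open>L\<^sup>1 \<inter> L\<^sup>p\<close>, \<open>p = 1 + s/d\<close>. Functions stand for their classes modulo
  null sets, hence nonnegativity is required almost everywhere only.\<close>

definition nonneg_L1_Lp :: "real \<Rightarrow> ('a::euclidean_space \<Rightarrow> real) set" where
  "nonneg_L1_Lp s = {\<rho>. integrable lborel \<rho> \<and> (AE x in lborel. 0 \<le> \<rho> x) \<and> L_fun s \<rho> < \<infinity>}"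

definition densities :: "real \<Rightarrow> nat \<Rightarrow> ('a::euclidean_space \<Rightarrow> real) set" where
  "densities s N = {\<rho> \<in> nonneg_L1_Lp s. (\<integral>x. \<rho> x \<partial>lborel) = real N}"

abbreviation config :: "nat \<Rightarrow> (nat \<Rightarrow> 'a::euclidean_space) measure" where
  "config k \<equiv> Pi\<^sub>M {..<k} (\<lambda>_. borel)"

text \<open>A permutation of \<open>{..<k}\<close> fixes all other indices, so \<open>x \<circ> \<pi>\<close> is again a configuration.\<close>

definition symmetric_measure :: "nat \<Rightarrow> (nat \<Rightarrow> 'a::euclidean_space) measure \<Rightarrow> bool" where
  "symmetric_measure k P \<longleftrightarrow>
     sets P = sets (config k) \<and> (\<forall>\<pi>. \<pi> permutes {..<k} \<longrightarrow> distr P P (\<lambda>x. x \<circ> \<pi>) = P)"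

definition sum_measures :: "'i set \<Rightarrow> ('i \<Rightarrow> 'a::euclidean_space measure) \<Rightarrow> 'a measure" where
  "sum_measures I M = measure_of UNIV (sets borel) (\<lambda>A. \<Sum>i\<in>I. emeasure (M i) A)"

definition one_body :: "nat \<Rightarrow> (nat \<Rightarrow> 'a::euclidean_space) measure \<Rightarrow> 'a measure" where
  "one_body k P = sum_measures {..<k} (\<lambda>i. distr P borel (\<lambda>x. x i))"

definition pair_energy :: "real \<Rightarrow> nat \<Rightarrow> (nat \<Rightarrow> 'a::euclidean_space) measure \<Rightarrow> ennreal" where
  "pair_energy s k P = (\<integral>\<^sup>+x. (\<Sum>j<k. \<Sum>i<j. riesz s (x i) (x j)) \<partial>P)"

text \<open>The infimum is attained for \<open>\<rho>\<close> in \<open>densities s N\<close>, so this is the minimum.\<close>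

definition W_N :: "real \<Rightarrow> nat \<Rightarrow> ('a::euclidean_space \<Rightarrow> real) \<Rightarrow> ennreal" where
  "W_N s N \<rho> = (INF P \<in> {P. prob_space P \<and> symmetric_measure N P \<and>
                             one_body N P = density lborel (\<lambda>x. ennreal (\<rho> x))}. pair_energy s N P)"

definition G_N :: "real \<Rightarrow> nat \<Rightarrow> ('a::euclidean_space \<Rightarrow> real) \<Rightarrow> ereal" where
  "G_N s N \<rho> = enn2ereal (D_fun s \<rho>) / 2 - enn2ereal (W_N s N \<rho>)"

text \<open>The type token \<open>'a\<close> carries the dimension \<open>d\<close>.\<close>

definition Lambda_N :: "'a::euclidean_space itself \<Rightarrow> real \<Rightarrow> nat \<Rightarrow> ereal" where
  "Lambda_N _ s N =
     (SUP \<rho> \<in> (densities s N :: ('a \<Rightarrow> real) set). G_N s N \<rho> / enn2ereal (L_fun s \<rho>))"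

text \<open>Only the sectors \<open>1, \<dots>, N\<close> are meaningful; the others are ignored by all definitions below.\<close>

record 'a grand_canonical =
  vacuum :: real
  sector :: "nat \<Rightarrow> (nat \<Rightarrow> 'a) measure"

definition mass :: "'b measure \<Rightarrow> real" where
  "mass M = measure M (space M)"

definition truncated_gc :: "nat \<Rightarrow> 'a::euclidean_space grand_canonical \<Rightarrow> bool" where
  "truncated_gc N \<Gamma> \<longleftrightarrow>
     0 \<le> vacuum \<Gamma> \<and>
     (\<forall>k\<in>{1..N}. finite_measure (sector \<Gamma> k) \<and> symmetric_measure k (sector \<Gamma> k)) \<and>
     vacuum \<Gamma> + (\<Sum>k=1..N. mass (sector \<Gamma> k)) = 1"

text \<open>The law of the particle number \<open>K\<close>, as a measure on \<open>{0, \<dots>, N}\<close>.\<close>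

definition number_law :: "nat \<Rightarrow> 'a::euclidean_space grand_canonical \<Rightarrow> nat measure" where
  "number_law N \<Gamma> =
     point_measure {0..N} (\<lambda>k. ennreal (if k = 0 then vacuum \<Gamma> else mass (sector \<Gamma> k)))"

definition gc_one_body :: "nat \<Rightarrow> 'a::euclidean_space grand_canonical \<Rightarrow> 'a measure" where
  "gc_one_body N \<Gamma> = sum_measures {1..N} (\<lambda>k. one_body k (sector \<Gamma> k))"

definition gc_W :: "real \<Rightarrow> nat \<Rightarrow> 'a::euclidean_space grand_canonical \<Rightarrow> ennreal" where
  "gc_W s N \<Gamma> = (\<Sum>k=2..N. pair_energy s k (sector \<Gamma> k))"

text \<open>Here \<open>\<rho>\<close> is the density of \<open>gc_one_body N \<Gamma>\<close>.\<close>

definition gc_G ::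
  "real \<Rightarrow> nat \<Rightarrow> 'a::euclidean_space grand_canonical \<Rightarrow> ('a \<Rightarrow> real) \<Rightarrow> ereal" where
  "gc_G s N \<Gamma> \<rho> = enn2ereal (D_fun s \<rho>) / 2 - enn2ereal (gc_W s N \<Gamma>)"

end

theory Submission imports Defs begin

text \<open>
  A canonical competitor for \<open>\<Lambda>\<close> is built from \<open>\<Gamma>\<close> by adding \<open>N - k\<close> independent particles to the
  sector \<open>k\<close>. Particles that are uniform on a ball of radius \<open>A \<rightarrow> \<infinity>\<close> cost nothing in the limit,
  which gives the inequality with \<open>\<le>\<close>. It becomes strict since \<open>Var K > 0\<close> provides a sector \<open>k\<close> of
  positive probability \<open>p\<close> with \<open>k < E K = m\<close>: in this sector, with probability \<open>\<epsilon> = \<delta> / p\<close>, one of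
  the added particles is instead taken uniform on a ball of radius \<open>\<eta> R\<close> at distance \<open>R\<close> from the
  origin. To leading order it raises \<open>D/2\<close> by \<open>\<delta> m R\<^sup>-\<^sup>s\<close> but \<open>W\<close> only by \<open>\<delta> k R\<^sup>-\<^sup>s\<close>, while
  \<open>L\<close> grows by at most \<open>O(\<delta> powr (1 + s/d) R\<^sup>-\<^sup>s) + o(R\<^sup>-\<^sup>s)\<close>; so for small \<open>\<delta>\<close> and
  large \<open>R\<close> the perturbation strictly improves the ratio.
\<close>

section \<open>Canonical states from mixtures of particle numbers\<close>

text \<open>With q = s/d, a mass \<delta> spread evenly over a ball of radius \<eta> R has
  \<open>L_fun\<close> equal to a constant times \<delta>^(1+q) R^-s: the same order in R as the
  gain \<delta> R^-s, but superlinear in \<delta>. This is why the radius of the ball is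
  proportional to its distance from the origin. The obstacle is that \<rho> is only known to be
  integrable, so its mass t(R) outside the ball of radius \<eta> R tends to 0 without any rate. It
  enters twice: some particles may sit close to the new one, and \<rho> overlaps the new ball in the
  mixed term of \<open>L_fun\<close>. Divided by \<delta> R^-s, the first error is of order t(R) and
  the second of order \<delta>^(q-1) t(R). This dictates the order of limits: \<eta> is fixed from k
  < m, then A \<rightarrow> \<infinity>, then R \<rightarrow> \<infinity> at fixed \<delta>, and
  only at the end \<delta> \<rightarrow> 0. The argument is by contradiction. The assumption that
  \<open>Lambda_N\<close> is at most the ratio of \<Gamma> bounds it from above by a real number and
  makes the zeroth-order terms cancel, so each competitor yields an inequality between perturbation
  terms only.\<close>

definition measure_sum :: "'b measure \<Rightarrow> 'i set \<Rightarrow> ('i \<Rightarrow> 'b measure) \<Rightarrow> 'b measure" where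
  "measure_sum S I M = measure_of (space S) (sets S) (\<lambda>A. \<Sum>i\<in>I. emeasure (M i) A)"

lemma sets_measure_sum [simp, measurable_cong]: "sets (measure_sum S I M) = sets S"
  and space_measure_sum [simp]: "space (measure_sum S I M) = space S"
  by (simp_all add: measure_sum_def)

lemma emeasure_measure_sum:
  assumes "finite I" "\<And>i. i \<in> I \<Longrightarrow> sets (M i) = sets S" "A \<in> sets S"
  shows "emeasure (measure_sum S I M) A = (\<Sum>i\<in>I. emeasure (M i) A)"
proof (rule emeasure_measure_of[OF measure_sum_def])
  show "countably_additive (sets (measure_sum S I M)) (\<lambda>A. \<Sum>i\<in>I. emeasure (M i) A)"
  proof (rule countably_additiveI)
    fix F :: "nat \<Rightarrow> _" assume F: "range F \<subseteq> sets (measure_sum S I M)" "disjoint_family F"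
    have "(\<Sum>n. \<Sum>i\<in>I. emeasure (M i) (F n)) = (\<Sum>i\<in>I. \<Sum>n. emeasure (M i) (F n))"
      by (rule suminf_sum) simp
    also have "\<dots> = (\<Sum>i\<in>I. emeasure (M i) (\<Union>n. F n))"
      using F assms(2) by (intro sum.cong refl suminf_emeasure) auto
    finally show "(\<Sum>n. \<Sum>i\<in>I. emeasure (M i) (F n)) = (\<Sum>i\<in>I. emeasure (M i) (\<Union>n. F n))" .
  qed
qed (use assms in \<open>auto simp: positive_def sets.space_closed\<close>)

lemma nn_integral_measure_sum:
  assumes I: "finite I" "\<And>i. i \<in> I \<Longrightarrow> sets (M i) = sets S" and f: "f \<in> borel_measurable S"
  shows "(\<integral>\<^sup>+x. f x \<partial>measure_sum S I M) = (\<Sum>i\<in>I. \<integral>\<^sup>+x. f x \<partial>M i)"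
  using f
proof (induction rule: borel_measurable_induct)
  case (cong f g)
  have "(\<integral>\<^sup>+x. f x \<partial>measure_sum S I M) = (\<integral>\<^sup>+x. g x \<partial>measure_sum S I M)"
    using cong by (intro nn_integral_cong) auto
  moreover have "(\<integral>\<^sup>+x. f x \<partial>M i) = (\<integral>\<^sup>+x. g x \<partial>M i)" if "i \<in> I" for i
    using cong sets_eq_imp_space_eq[OF I(2)[OF that]] by (intro nn_integral_cong) auto
  ultimately show ?case
    using cong by simp
next
  case (set A)
  have "(\<integral>\<^sup>+x. indicator A x \<partial>M i) = emeasure (M i) A" if "i \<in> I" for i
    using set I(2)[OF that] by (intro nn_integral_indicator) auto
  then show ?case
    using set by (simp add: emeasure_measure_sum I)
next
  case (mult u c)
  have [measurable]: "u \<in> borel_measurable (M i)" if "i \<in> I" for i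
    using mult measurable_cong_sets[OF I(2)[OF that] refl] by auto
  show ?case
    using mult by (simp add: nn_integral_cmult sum_distrib_left)
next
  case (add u v)
  have [measurable]: "u \<in> borel_measurable (M i)" "v \<in> borel_measurable (M i)" if "i \<in> I" for i
    using \<open>u \<in> borel_measurable S\<close> \<open>v \<in> borel_measurable S\<close> measurable_cong_sets[OF I(2)[OF that] refl] by auto
  show ?case
    using add by (simp add: nn_integral_add sum.distrib)
next
  case (seq U)
  have [measurable]: "U n \<in> borel_measurable (M i)" if "i \<in> I" for i n
    using seq(1) measurable_cong_sets[OF I(2)[OF that] refl] by auto
  have inc: "incseq (\<lambda>n. \<integral>\<^sup>+x. U n x \<partial>N)" for N
    using seq by (intro monoI nn_integral_mono) (auto simp: incseq_def le_fun_def)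
  have "(\<integral>\<^sup>+x. (SUP n. U n) x \<partial>measure_sum S I M) = (SUP n. \<Sum>i\<in>I. \<integral>\<^sup>+x. U n x \<partial>M i)"
    unfolding SUP_apply using seq by (subst nn_integral_monotone_convergence_SUP) simp_all
  also have "\<dots> = (\<Sum>i\<in>I. SUP n. \<integral>\<^sup>+x. U n x \<partial>M i)"
    using inc by (intro ennreal_SUP_sum) auto
  also have "\<dots> = (\<Sum>i\<in>I. \<integral>\<^sup>+x. (SUP n. U n) x \<partial>M i)"
    unfolding SUP_apply using seq(3)
    by (intro sum.cong refl nn_integral_monotone_convergence_SUP[symmetric]) simp_all
  finally show ?case .
qed

text \<open>\<open>measure_sum\<close> has a base measure for its sigma-algebra so that one
  construction serves one-body measures (base \<open>borel\<close>) as well as mixtures of states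
  and averages over permutations (base \<open>config N\<close>).\<close>

lemma sum_measures_eq_measure_sum: "sum_measures I M = measure_sum borel I M"
  by (simp add: sum_measures_def measure_sum_def)

lemma sets_one_body [simp, measurable_cong]: "sets (one_body k Q) = sets borel"
  and space_one_body [simp]: "space (one_body k Q) = UNIV"
  by (simp_all add: one_body_def sum_measures_eq_measure_sum)

lemma nn_integral_one_body:
  assumes Q[measurable_cong]: "sets Q = sets (config k)" and [measurable]: "f \<in> borel_measurable borel"
  shows "(\<integral>\<^sup>+y. f y \<partial>one_body k Q) = (\<integral>\<^sup>+x. (\<Sum>i<k. f (x i)) \<partial>Q)"
proof -
  have [measurable]: "(\<lambda>x. x i) \<in> measurable Q borel" if "i < k" for i
    unfolding measurable_cong_sets[OF Q refl] using that by simp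
  have "(\<integral>\<^sup>+y. f y \<partial>one_body k Q) = (\<Sum>i<k. \<integral>\<^sup>+x. f (x i) \<partial>Q)"
    unfolding one_body_def sum_measures_eq_measure_sum
    by (subst nn_integral_measure_sum) (auto simp: nn_integral_distr)
  also have "\<dots> = (\<integral>\<^sup>+x. (\<Sum>i<k. f (x i)) \<partial>Q)"
    by (subst nn_integral_sum) auto
  finally show ?thesis .
qed

section \<open>Adding independent particles to a state\<close>

lemma measurable_riesz [measurable]:
  assumes [measurable]: "f \<in> borel_measurable M" "g \<in> borel_measurable M"
  shows "(\<lambda>x. riesz s (f x) (g x)) \<in> borel_measurable M"
  unfolding riesz_def by measurable

lemma riesz_commute: "riesz s x y = riesz s y x"
  by (simp add: riesz_def norm_minus_commute)

text \<open>The new particle takes the last index and is independent of the others. The result is in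
  general not symmetric; symmetrization is postponed until all particles are present, since it
  changes neither the one-body measure nor the pair energy.\<close>

definition append_particle ::
  "nat \<Rightarrow> (nat \<Rightarrow> 'a::euclidean_space) measure \<Rightarrow> 'a measure \<Rightarrow> (nat \<Rightarrow> 'a) measure" where
  "append_particle k Q \<mu> = distr (Q \<Otimes>\<^sub>M \<mu>) (config (Suc k)) (\<lambda>(x, y). x(k := y))"

lemma sets_append_particle [simp, measurable_cong]:
  "sets (append_particle k Q \<mu>) = sets (config (Suc k))"
  by (simp add: append_particle_def)

context
  fixes k :: nat and Q :: "(nat \<Rightarrow> 'a::euclidean_space) measure" and \<mu> :: "'a measure"
  assumes sets_Q [measurable_cong]: "sets Q = sets (config k)"
    and finQ: "finite_measure Q"
    and sets_\<mu> [measurable_cong]: "sets \<mu> = sets borel" and prob_\<mu>: "prob_space \<mu>"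
begin

lemma measurable_append [measurable]:
  "(\<lambda>(x, y). x(k := y)) \<in> measurable (Q \<Otimes>\<^sub>M \<mu>) (config (Suc k))"
proof -
  have "(\<lambda>z. (fst z)(k := snd z)) \<in> measurable (Q \<Otimes>\<^sub>M \<mu>) (Pi\<^sub>M (insert k {..<k}) (\<lambda>_. borel))"
    by (rule measurable_fun_upd[where J="{..<k}"]) (auto intro: measurable_fst' measurable_snd')
  then show ?thesis
    by (simp add: lessThan_Suc case_prod_beta')
qed

lemma nn_integral_append_particle:
  assumes [measurable]: "f \<in> borel_measurable (config (Suc k))"
  shows "(\<integral>\<^sup>+x. f x \<partial>append_particle k Q \<mu>) = (\<integral>\<^sup>+x. \<integral>\<^sup>+y. f (x(k := y)) \<partial>\<mu> \<partial>Q)"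
proof -
  interpret Q: finite_measure Q by (rule finQ)
  interpret \<mu>: prob_space \<mu> by (rule prob_\<mu>)
  show ?thesis
    unfolding append_particle_def
    by (subst nn_integral_distr)
      (auto simp: \<mu>.nn_integral_fst[symmetric] split_beta')
qed

lemma emeasure_space_append_particle:
  "emeasure (append_particle k Q \<mu>) (space (append_particle k Q \<mu>)) = emeasure Q (space Q)"
  using nn_integral_append_particle[of "\<lambda>_. 1"] prob_space.emeasure_space_1[OF prob_\<mu>] by simp

lemma finite_append_particle: "finite_measure (append_particle k Q \<mu>)"
  using emeasure_space_append_particle finite_measure.emeasure_finite[OF finQ]
  by (intro finite_measureI) simp

lemma one_body_append_particle:
  assumes [measurable]: "f \<in> borel_measurable borel"
  shows "(\<integral>\<^sup>+y. f y \<partial>one_body (Suc k) (append_particle k Q \<mu>)) =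
    (\<integral>\<^sup>+y. f y \<partial>one_body k Q) + emeasure Q (space Q) * (\<integral>\<^sup>+y. f y \<partial>\<mu>)"
proof -
  interpret \<mu>: prob_space \<mu> by (rule prob_\<mu>)
  have "(\<integral>\<^sup>+y. f y \<partial>one_body (Suc k) (append_particle k Q \<mu>)) =
      (\<integral>\<^sup>+x. \<integral>\<^sup>+y. (\<Sum>i<k. f (x i)) + f y \<partial>\<mu> \<partial>Q)"
    by (subst nn_integral_one_body, simp, simp, subst nn_integral_append_particle)
      (auto intro!: nn_integral_cong arg_cong2[where f="(+)"] sum.cong)
  also have "\<dots> = (\<integral>\<^sup>+x. (\<Sum>i<k. f (x i)) + (\<integral>\<^sup>+y. f y \<partial>\<mu>) \<partial>Q)"
    by (subst nn_integral_add) (auto simp: \<mu>.emeasure_space_1)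
  also have "\<dots> = (\<integral>\<^sup>+y. f y \<partial>one_body k Q) + emeasure Q (space Q) * (\<integral>\<^sup>+y. f y \<partial>\<mu>)"
    by (subst nn_integral_add) (auto simp: nn_integral_one_body sets_Q mult.commute)
  finally show ?thesis .
qed

text \<open>The new pairs are those of index \<open>k\<close> with some \<open>i < k\<close>. By
  independence their energy can be integrated over the new particle first, which leaves the
  potential of \<open>\<mu>\<close> integrated against the one-body measure of \<open>Q\<close>. The
  old pairs keep their energy because \<open>\<mu>\<close> has mass 1.\<close>

lemma pair_energy_append_particle:
  "pair_energy s (Suc k) (append_particle k Q \<mu>) =
    pair_energy s k Q + (\<integral>\<^sup>+x. (\<integral>\<^sup>+y. riesz s x y \<partial>\<mu>) \<partial>one_body k Q)"
proof -
  interpret \<mu>: prob_space \<mu> by (rule prob_\<mu>)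
  have "pair_energy s (Suc k) (append_particle k Q \<mu>) =
      (\<integral>\<^sup>+x. \<integral>\<^sup>+y. (\<Sum>j<k. \<Sum>i<j. riesz s (x i) (x j)) + (\<Sum>i<k. riesz s (x i) y) \<partial>\<mu> \<partial>Q)"
    unfolding pair_energy_def
    by (subst nn_integral_append_particle)
      (auto intro!: nn_integral_cong arg_cong2[where f="(+)"] sum.cong)
  also have "\<dots> = (\<integral>\<^sup>+x. (\<Sum>j<k. \<Sum>i<j. riesz s (x i) (x j)) + (\<Sum>i<k. \<integral>\<^sup>+y. riesz s (x i) y \<partial>\<mu>) \<partial>Q)"
    by (auto simp: nn_integral_add nn_integral_sum \<mu>.emeasure_space_1 intro!: nn_integral_cong)
  also have "\<dots> = pair_energy s k Q + (\<integral>\<^sup>+x. (\<integral>\<^sup>+y. riesz s x y \<partial>\<mu>) \<partial>one_body k Q)"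
    unfolding pair_energy_def
    by (subst nn_integral_add) (auto simp: nn_integral_one_body sets_Q)
  finally show ?thesis .
qed

end

primrec fill_up :: "'a::euclidean_space measure \<Rightarrow> nat \<Rightarrow> (nat \<Rightarrow> 'a) measure \<Rightarrow> nat \<Rightarrow> (nat \<Rightarrow> 'a) measure"
where
  "fill_up \<mu> k Q 0 = Q"
| "fill_up \<mu> k Q (Suc n) = append_particle (k + n) (fill_up \<mu> k Q n) \<mu>"

lemma emeasure_one_body_UNIV:
  assumes "sets Q = sets (config k)"
  shows "emeasure (one_body k Q) UNIV = of_nat k * emeasure Q (space Q)"
  using nn_integral_one_body[OF assms, of "\<lambda>_. 1"] by simp

context
  fixes k :: nat and Q :: "(nat \<Rightarrow> 'a::euclidean_space) measure" and \<mu> :: "'a measure"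
  assumes sets_Q: "sets Q = sets (config k)"
    and finQ: "finite_measure Q"
    and sets_\<mu>: "sets \<mu> = sets borel" and prob_\<mu>: "prob_space \<mu>"
begin

lemma fill_up_measure:
  "sets (fill_up \<mu> k Q n) = sets (config (k + n)) \<and> finite_measure (fill_up \<mu> k Q n) \<and>
   emeasure (fill_up \<mu> k Q n) (space (fill_up \<mu> k Q n)) = emeasure Q (space Q)"
  by (induction n)
    (auto simp: sets_Q finQ sets_\<mu> prob_\<mu> finite_append_particle emeasure_space_append_particle)

lemma one_body_fill_up:
  assumes [measurable]: "f \<in> borel_measurable borel"
  shows "(\<integral>\<^sup>+y. f y \<partial>one_body (k + n) (fill_up \<mu> k Q n)) =
    (\<integral>\<^sup>+y. f y \<partial>one_body k Q) + of_nat n * emeasure Q (space Q) * (\<integral>\<^sup>+y. f y \<partial>\<mu>)"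
proof (induction n)
  case (Suc n)
  show ?case
    using Suc by (simp add: one_body_append_particle fill_up_measure sets_\<mu> prob_\<mu> algebra_simps)
qed simp

end

text \<open>When \<open>k + j\<close> particles are present, the one-body measure has
  \<open>k + j\<close> times the mass of \<open>Q\<close>, so the next particle costs at most that
  times \<open>v\<close>. The sum of \<open>k + j\<close> over \<open>j < n\<close> is estimated
  crudely by \<open>n * (k + n)\<close>; in the application \<open>v\<close> becomes arbitrarily
  small.\<close>

lemma pair_energy_fill_up_le:
  fixes \<mu> :: "'a::euclidean_space measure"
  assumes Q: "sets Q = sets (config k)" "finite_measure Q"
    and \<mu>: "sets \<mu> = sets borel" "prob_space \<mu>"
    and v: "\<And>x. (\<integral>\<^sup>+y. riesz s x y \<partial>\<mu>) \<le> v"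
  shows "pair_energy s (k + n) (fill_up \<mu> k Q n) \<le>
    pair_energy s k Q + of_nat (n * (k + n)) * emeasure Q (space Q) * v"
proof (induction n)
  case (Suc n)
  let ?m = "emeasure Q (space Q)"
  have "(\<integral>\<^sup>+x. (\<integral>\<^sup>+y. riesz s x y \<partial>\<mu>) \<partial>one_body (k + n) (fill_up \<mu> k Q n)) \<le>
      (\<integral>\<^sup>+x. v \<partial>one_body (k + n) (fill_up \<mu> k Q n))"
    by (intro nn_integral_mono v)
  also have "\<dots> = of_nat (k + n) * ?m * v"
    using fill_up_measure[OF Q \<mu>, of n] emeasure_one_body_UNIV[of "fill_up \<mu> k Q n" "k + n"]
    by (simp add: mult.commute)
  finally have "pair_energy s (k + Suc n) (fill_up \<mu> k Q (Suc n)) \<le>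
      pair_energy s k Q + of_nat (n * (k + n)) * ?m * v + of_nat (k + n) * ?m * v"
    using Suc by (simp add: pair_energy_append_particle fill_up_measure Q \<mu> add_mono)
  also have "\<dots> = pair_energy s k Q + of_nat (n * (k + n) + (k + n)) * ?m * v"
    by (simp only: of_nat_add distrib_right add.assoc)
  also have "\<dots> \<le> pair_energy s k Q + of_nat (Suc n * (k + Suc n)) * ?m * v"
    by (intro add_left_mono mult_right_mono of_nat_mono) auto
  finally show ?case .
qed simp

section \<open>Symmetrization over particle labels\<close>

definition symmetrize :: "nat \<Rightarrow> (nat \<Rightarrow> 'a::euclidean_space) measure \<Rightarrow> (nat \<Rightarrow> 'a) measure" where
  "symmetrize N M = measure_sum (config N) {\<pi>. \<pi> permutes {..<N}}
     (\<lambda>\<pi>. scale_measure (1 / fact N) (distr M (config N) (\<lambda>x. x \<circ> \<pi>)))"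

lemma sets_symmetrize [simp, measurable_cong]: "sets (symmetrize N M) = sets (config N)"
  by (simp add: symmetrize_def)

lemma measurable_permute:
  assumes "\<pi> permutes {..<N}"
  shows "(\<lambda>x. x \<circ> \<pi>) \<in> measurable (config N) (config N :: (nat \<Rightarrow> 'a::euclidean_space) measure)"
proof (rule measurable_PiM_single')
  fix i assume "i \<in> {..<N}"
  then have "\<pi> i \<in> {..<N}"
    using assms permutes_in_image by metis
  then show "(\<lambda>x. (x \<circ> \<pi>) i) \<in> measurable (config N) (borel :: 'a measure)"
    by (simp add: comp_def)
next
  show "(\<lambda>x. x \<circ> \<pi>) \<in> space (config N) \<rightarrow> (\<Pi>\<^sub>E i\<in>{..<N}. space (borel :: 'a measure))"
    using assms by (fastforce simp: space_PiM PiE_def extensional_def permutes_def)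
qed

lemma nn_integral_symmetrize:
  assumes M: "sets M = sets (config N)" and f: "f \<in> borel_measurable (config N)"
  shows "(\<integral>\<^sup>+x. f x \<partial>symmetrize N M) =
    (\<Sum>\<pi> | \<pi> permutes {..<N}. (1 / fact N) * (\<integral>\<^sup>+x. f (x \<circ> \<pi>) \<partial>M))"
proof -
  note [measurable_cong] = M and [measurable] = f measurable_permute
  have mp: "(\<lambda>x. x \<circ> \<pi>) \<in> measurable M (config N)" if "\<pi> permutes {..<N}" for \<pi>
    unfolding measurable_cong_sets[OF M refl] by (rule measurable_permute[OF that])
  show ?thesis
    unfolding symmetrize_def
    by (subst nn_integral_measure_sum)
      (auto simp: finite_permutations nn_integral_scale_measure nn_integral_distr mp f intro!: sum.cong)
qed

text \<open>One-body measures and pair energies are integrals of permutation invariant functions, so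
  this carries both over from the labelled state to its symmetrization.\<close>

lemma nn_integral_symmetrize_invariant:
  assumes M: "sets M = sets (config N)" and f: "f \<in> borel_measurable (config N)"
    and inv: "\<And>\<pi> x. \<pi> permutes {..<N} \<Longrightarrow> f (x \<circ> \<pi>) = f x"
  shows "(\<integral>\<^sup>+x. f x \<partial>symmetrize N M) = (\<integral>\<^sup>+x. f x \<partial>M)"
proof -
  have "(\<integral>\<^sup>+x. f x \<partial>symmetrize N M) = (\<Sum>\<pi> | \<pi> permutes {..<N}. (1 / fact N) * (\<integral>\<^sup>+x. f x \<partial>M))"
    by (subst nn_integral_symmetrize[OF M f]) (auto simp: inv intro!: sum.cong)
  also have "\<dots> = (of_nat (fact N) * (1 / fact N)) * (\<integral>\<^sup>+x. f x \<partial>M)"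
    by (simp add: card_permutations[of _ N] mult.assoc)
  also have "of_nat (fact N) * (1 / fact N) = (1 :: ennreal)"
  proof -
    have "(fact N :: ennreal) < \<top>"
      by (metis of_nat_fact of_nat_less_top)
    then show ?thesis
      by (simp add: ennreal_times_divide ennreal_divide_self)
  qed
  finally show ?thesis by simp
qed

lemma symmetric_symmetrize:
  fixes M :: "(nat \<Rightarrow> 'a::euclidean_space) measure"
  assumes M: "sets M = sets (config N)"
  shows "symmetric_measure N (symmetrize N M)"
  unfolding symmetric_measure_def
proof (intro conjI allI impI)
  fix \<sigma> assume \<sigma>: "\<sigma> permutes {..<N}"
  let ?P = "symmetrize N M"
  have m: "(\<lambda>x. x \<circ> \<pi>) \<in> measurable ?P ?P" if "\<pi> permutes {..<N}" for \<pi>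
    unfolding measurable_cong_sets[OF sets_symmetrize sets_symmetrize] by (rule measurable_permute[OF that])
  show "distr ?P ?P (\<lambda>x. x \<circ> \<sigma>) = ?P"
  proof (rule measure_eqI)
    fix A assume "A \<in> sets (distr ?P ?P (\<lambda>x. x \<circ> \<sigma>))"
    then have A: "A \<in> sets (config N)" by simp
    have "emeasure (distr ?P ?P (\<lambda>x. x \<circ> \<sigma>)) A = (\<integral>\<^sup>+x. indicator A x \<partial>distr ?P ?P (\<lambda>x. x \<circ> \<sigma>))"
      using A by simp
    also have "\<dots> = (\<integral>\<^sup>+x. indicator A (x \<circ> \<sigma>) \<partial>?P)"
      using A by (subst nn_integral_distr[OF m[OF \<sigma>]]) auto
    also have "\<dots> = (\<Sum>\<pi> | \<pi> permutes {..<N}. (1 / fact N) * (\<integral>\<^sup>+x. indicator A (x \<circ> (\<pi> \<circ> \<sigma>)) \<partial>M))"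
      using A by (subst nn_integral_symmetrize[OF M])
        (auto simp: comp_assoc intro!: measurable_compose[OF measurable_permute[OF \<sigma>]])
    \<comment> \<open>Composition with \<open>\<sigma>\<close> permutes the summands of the
      average.\<close>
    also have "\<dots> = (\<Sum>\<pi> | \<pi> permutes {..<N}. (1 / fact N) * (\<integral>\<^sup>+x. indicator A (x \<circ> \<pi>) \<partial>M))"
      using sum_permutations_compose_right[OF \<sigma>, of "\<lambda>\<pi>. (1 / fact N) * (\<integral>\<^sup>+x. indicator A (x \<circ> \<pi>) \<partial>M)"] by simp
    also have "\<dots> = (\<integral>\<^sup>+x. indicator A x \<partial>?P)"
      using A by (subst nn_integral_symmetrize[OF M]) auto
    finally show "emeasure (distr ?P ?P (\<lambda>x. x \<circ> \<sigma>)) A = emeasure ?P A"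
      using A by simp
  qed simp
qed simp

lemma emeasure_space_symmetrize:
  assumes M: "sets M = sets (config N)"
  shows "emeasure (symmetrize N M) (space (symmetrize N M)) = emeasure M (space M)"
  using nn_integral_symmetrize_invariant[OF M, of "\<lambda>_. 1"] by simp

lemma one_body_symmetrize:
  fixes M :: "(nat \<Rightarrow> 'a::euclidean_space) measure"
  assumes M: "sets M = sets (config N)"
  shows "one_body N (symmetrize N M) = one_body N M"
proof (rule measure_eqI)
  fix A assume "A \<in> sets (one_body N (symmetrize N M))"
  then have [measurable]: "A \<in> sets borel" by simp
  have "(\<integral>\<^sup>+y. indicator A y \<partial>one_body N (symmetrize N M)) =
      (\<integral>\<^sup>+x. (\<Sum>i<N. indicator A (x i)) \<partial>symmetrize N M)"
    by (rule nn_integral_one_body) auto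
  also have "\<dots> = (\<integral>\<^sup>+x. (\<Sum>i<N. indicator A (x i)) \<partial>M)"
  proof (rule nn_integral_symmetrize_invariant[OF M])
    fix \<pi> and x :: "nat \<Rightarrow> 'a" assume "\<pi> permutes {..<N}"
    then show "(\<Sum>i<N. indicator A ((x \<circ> \<pi>) i) :: ennreal) = (\<Sum>i<N. indicator A (x i))"
      using sum.permute[of \<pi> "{..<N}" "\<lambda>i. indicator A (x i) :: ennreal"] by (simp add: comp_def)
  qed measurable
  also have "\<dots> = (\<integral>\<^sup>+y. indicator A y \<partial>one_body N M)"
    by (rule nn_integral_one_body[symmetric]) (auto simp: M)
  finally show "emeasure (one_body N (symmetrize N M)) A = emeasure (one_body N M) A"
    by simp
qed simp

text \<open>A permutation does not respect the condition \<open>i < j\<close>, but the sum over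
  ordered pairs is visibly invariant. The diagonal must be cut out because \<open>riesz\<close> is
  infinite there.\<close>

lemma sum_pairs_eq:
  fixes N :: nat
  shows "(\<Sum>i<N. \<Sum>j<N. if i = j then 0 else riesz s (x i) (x j)) = 2 * (\<Sum>j<N. \<Sum>i<j. riesz s (x i) (x j))"
proof (induction N)
  case (Suc N)
  have a: "(\<Sum>i<N. if i = N then 0 else riesz s (x i) (x N)) = (\<Sum>i<N. riesz s (x i) (x N))"
    and b: "(\<Sum>i<N. if N = i then 0 else riesz s (x N) (x i)) = (\<Sum>i<N. riesz s (x i) (x N))"
    by (auto intro!: sum.cong simp: riesz_commute)
  show ?case
    by (simp only: sum.lessThan_Suc sum.distrib Suc a b distrib_left mult_2 if_True refl ac_simps add_0_left add_0_right)
qed simp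

lemma sum_pairs_permute:
  fixes N :: nat
  assumes "\<pi> permutes {..<N}"
  shows "(\<Sum>j<N. \<Sum>i<j. riesz s ((x \<circ> \<pi>) i) ((x \<circ> \<pi>) j)) = (\<Sum>j<N. \<Sum>i<j. riesz s (x i) (x j))"
proof -
  have inj: "\<pi> i = \<pi> j \<longleftrightarrow> i = j" for i j
    using assms by (metis permutes_inj injD)
  define f where "f = (\<lambda>i j. if i = j then 0 else riesz s (x i) (x j))"
  have "2 * (\<Sum>j<N. \<Sum>i<j. riesz s ((x \<circ> \<pi>) i) ((x \<circ> \<pi>) j)) = (\<Sum>i<N. \<Sum>j<N. f (\<pi> i) (\<pi> j))"
    using sum_pairs_eq[where x="x \<circ> \<pi>" and N=N and s=s] by (simp add: inj f_def cong: if_cong)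
  also have "\<dots> = (\<Sum>i<N. \<Sum>j<N. f (\<pi> i) j)"
    using sum.permute[OF assms, of "f (\<pi> i)" for i] by (simp add: comp_def)
  also have "\<dots> = (\<Sum>i<N. \<Sum>j<N. f i j)"
    using sum.permute[OF assms, of "\<lambda>i. \<Sum>j<N. f i j"] by (simp add: comp_def)
  also have "\<dots> = 2 * (\<Sum>j<N. \<Sum>i<j. riesz s (x i) (x j))"
    unfolding f_def sum_pairs_eq ..
  finally show ?thesis
    by (simp add: ennreal_mult_cancel_left)
qed

lemma pair_energy_symmetrize:
  fixes M :: "(nat \<Rightarrow> 'a::euclidean_space) measure"
  assumes M: "sets M = sets (config N)"
  shows "pair_energy s N (symmetrize N M) = pair_energy s N M"
  unfolding pair_energy_def
  by (rule nn_integral_symmetrize_invariant[OF M]) (auto simp only: sum_pairs_permute, measurable)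

text \<open>Fill every component up to \<open>N\<close> particles, add the results and symmetrize;
  masses that sum to 1 give a probability. The filling particles add only a multiple of
  \<open>\<mu>\<close> to the one-body measure and at most \<open>N * N * v\<close> to the energy.
  The index \<open>i\<close> is kept apart from the particle number \<open>n i\<close>, since a
  split sector later contributes a further component with \<open>Suc k\<close> particles.\<close>

lemma canonical_from_mixture:
  fixes Q :: "'i \<Rightarrow> (nat \<Rightarrow> 'a::euclidean_space) measure"
  assumes I: "finite I"
    and Q: "\<And>i. i \<in> I \<Longrightarrow> sets (Q i) = sets (config (n i))" "\<And>i. i \<in> I \<Longrightarrow> finite_measure (Q i)"
    and n: "\<And>i. i \<in> I \<Longrightarrow> n i \<le> N"
    and mass: "(\<Sum>i\<in>I. emeasure (Q i) (space (Q i))) = 1"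
    and \<mu>: "sets \<mu> = sets borel" "prob_space \<mu>"
    and v: "\<And>x. (\<integral>\<^sup>+y. riesz s x y \<partial>\<mu>) \<le> v"
  obtains P where "prob_space P" "symmetric_measure N P"
    "\<And>A. A \<in> sets borel \<Longrightarrow> emeasure (one_body N P) A =
      (\<Sum>i\<in>I. emeasure (one_body (n i) (Q i)) A) +
      (\<Sum>i\<in>I. of_nat (N - n i) * emeasure (Q i) (space (Q i))) * emeasure \<mu> A"
    "pair_energy s N P \<le> (\<Sum>i\<in>I. pair_energy s (n i) (Q i)) + of_nat (N * N) * v"
proof
  define F where "F i = fill_up \<mu> (n i) (Q i) (N - n i)" for i
  define M where "M = measure_sum (config N) I F"
  have F: "sets (F i) = sets (config N)"
      "emeasure (F i) (space (F i)) = emeasure (Q i) (space (Q i))" if "i \<in> I" for i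
    using fill_up_measure[OF Q(1)[OF that] Q(2)[OF that] \<mu>, of "N - n i"] n[OF that] by (auto simp: F_def)
  have M: "sets M = sets (config N)" by (simp add: M_def)
  have intM: "(\<integral>\<^sup>+x. f x \<partial>M) = (\<Sum>i\<in>I. \<integral>\<^sup>+x. f x \<partial>F i)" if "f \<in> borel_measurable (config N)" for f
    unfolding M_def by (rule nn_integral_measure_sum) (use I F that in auto)
  let ?P = "symmetrize N M"
  have "emeasure M (space M) = 1"
    using intM[of "\<lambda>_. 1"] mass by (simp add: F)
  then show "prob_space ?P"
    by (intro prob_spaceI) (simp add: emeasure_space_symmetrize[OF M])
  show "symmetric_measure N ?P"
    by (rule symmetric_symmetrize[OF M])
  show "emeasure (one_body N ?P) A = (\<Sum>i\<in>I. emeasure (one_body (n i) (Q i)) A) +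
      (\<Sum>i\<in>I. of_nat (N - n i) * emeasure (Q i) (space (Q i))) * emeasure \<mu> A"
    if [measurable]: "A \<in> sets borel" for A
  proof -
    have "emeasure (one_body N ?P) A = (\<integral>\<^sup>+y. indicator A y \<partial>one_body N M)"
      by (simp add: one_body_symmetrize[OF M])
    also have "\<dots> = (\<Sum>i\<in>I. \<integral>\<^sup>+y. indicator A y \<partial>one_body N (F i))"
      by (subst nn_integral_one_body, simp add: M, simp, subst intM)
        (auto simp: nn_integral_one_body F simp del: nn_integral_indicator intro!: sum.cong)
    also have "\<dots> = (\<Sum>i\<in>I. emeasure (one_body (n i) (Q i)) A +
        of_nat (N - n i) * emeasure (Q i) (space (Q i)) * emeasure \<mu> A)"
    proof (rule sum.cong[OF refl])
      fix i assume i: "i \<in> I"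
      show "(\<integral>\<^sup>+y. indicator A y \<partial>one_body N (F i)) = emeasure (one_body (n i) (Q i)) A +
        of_nat (N - n i) * emeasure (Q i) (space (Q i)) * emeasure \<mu> A"
        using one_body_fill_up[OF Q(1)[OF i] Q(2)[OF i] \<mu>, of "indicator A" "N - n i"] n[OF i]
        by (simp add: F_def \<mu>)
    qed
    finally show ?thesis
      by (simp add: sum.distrib sum_distrib_right)
  qed
  have "pair_energy s N ?P = (\<Sum>i\<in>I. pair_energy s N (F i))"
    unfolding pair_energy_symmetrize[OF M] unfolding pair_energy_def by (rule intM) measurable
  also have "\<dots> \<le> (\<Sum>i\<in>I. pair_energy s (n i) (Q i) + of_nat (N * N) * emeasure (Q i) (space (Q i)) * v)"
  proof (rule sum_mono)
    fix i assume i: "i \<in> I"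
    have "(N - n i) * N \<le> N * N" by (intro mult_right_mono) auto
    then have "pair_energy s (n i) (Q i) + of_nat ((N - n i) * N) * emeasure (Q i) (space (Q i)) * v
      \<le> pair_energy s (n i) (Q i) + of_nat (N * N) * emeasure (Q i) (space (Q i)) * v"
      by (intro add_left_mono mult_right_mono of_nat_mono) auto
    then show "pair_energy s N (F i) \<le>
        pair_energy s (n i) (Q i) + of_nat (N * N) * emeasure (Q i) (space (Q i)) * v"
      by (rule order_trans[rotated])
        (use pair_energy_fill_up_le[OF Q(1)[OF i] Q(2)[OF i] \<mu> v, of "N - n i"] n[OF i]
in \<open>simp add: F_def\<close>)
  qed
  also have "\<dots> = (\<Sum>i\<in>I. pair_energy s (n i) (Q i)) + of_nat (N * N) * v"
    using mass by (simp add: sum.distrib sum_distrib_left[symmetric] sum_distrib_right[symmetric])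
  finally show "pair_energy s N ?P \<le> (\<Sum>i\<in>I. pair_energy s (n i) (Q i)) + of_nat (N * N) * v" .
qed

section \<open>Uniform distributions on balls\<close>

definition uniform_ball :: "'a::euclidean_space \<Rightarrow> real \<Rightarrow> 'a \<Rightarrow> real" where
  "uniform_ball c r x = indicator (ball c r) x / (unit_ball_vol (real DIM('a)) * r ^ DIM('a))"

declare borel_open [OF open_ball, measurable]

lemma measurable_uniform_ball [measurable]: "uniform_ball c r \<in> borel_measurable borel"
  unfolding uniform_ball_def
  by measurable

lemma uniform_ball_nonneg: "0 < r \<Longrightarrow> 0 \<le> uniform_ball c r x"
  by (simp add: uniform_ball_def)

lemma nn_integral_uniform_ball_times:
  fixes c :: "'a::euclidean_space"
  assumes r: "0 < r" and [measurable]: "f \<in> borel_measurable borel" 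
  shows "(\<integral>\<^sup>+y. ennreal (uniform_ball c r y) * f y \<partial>lborel) =
    ennreal (1 / (unit_ball_vol (real DIM('a)) * r ^ DIM('a))) * (\<integral>\<^sup>+y. f y * indicator (ball c r) y \<partial>lborel)"
  by (subst nn_integral_cmult[symmetric])
    (auto simp: uniform_ball_def indicator_def intro!: nn_integral_cong)

lemma unit_ball_vol_DIM_neq_0 [simp]: "unit_ball_vol (real DIM('a::euclidean_space)) \<noteq> 0"
  by (rule less_imp_neq[symmetric]) simp

lemma nn_integral_uniform_ball:
  fixes c :: "'a::euclidean_space"
  assumes r: "0 < r"
  shows "(\<integral>\<^sup>+y. ennreal (uniform_ball c r y) \<partial>lborel) = 1"
  using nn_integral_uniform_ball_times[OF r, of "\<lambda>_. 1" c] r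
  by (simp add: emeasure_ball ennreal_mult[symmetric])

lemma prob_space_uniform_ball:
  assumes r: "0 < r"
  shows "prob_space (density lborel (\<lambda>y. ennreal (uniform_ball c r y)))"
  by (intro prob_spaceI) (simp add: emeasure_density nn_integral_uniform_ball[OF r])

section \<open>Riesz potentials of uniform distributions on balls\<close>

lemma riesz_eq: "x \<noteq> y \<Longrightarrow> riesz s x y = ennreal (norm (x - y) powr - s)"
  by (simp add: riesz_def powr_minus divide_ennreal[symmetric] ennreal_1[symmetric] inverse_eq_divide del: ennreal_1)

lemma uniform_ball_potential_le_dist:
  assumes r: "0 < r" and s: "0 < s" and a: "0 < a" and le: "\<And>y. y \<in> ball c r \<Longrightarrow> a \<le> norm (x - y)"
  shows "(\<integral>\<^sup>+y. ennreal (uniform_ball c r y) * riesz s x y \<partial>lborel) \<le> ennreal (a powr - s)"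
proof -
  have "(\<integral>\<^sup>+y. ennreal (uniform_ball c r y) * riesz s x y \<partial>lborel) \<le>
      (\<integral>\<^sup>+y. ennreal (uniform_ball c r y) * ennreal (a powr - s) \<partial>lborel)"
  proof (rule nn_integral_mono)
    fix y
    show "ennreal (uniform_ball c r y) * riesz s x y \<le> ennreal (uniform_ball c r y) * ennreal (a powr - s)"
    proof (cases "y \<in> ball c r")
      case True
      then have "x \<noteq> y" "norm (x - y) powr - s \<le> a powr - s"
        using le[OF True] a s by (auto intro!: powr_mono2')
      then show ?thesis
        by (intro mult_left_mono) (auto simp: riesz_eq intro!: ennreal_leI)
    qed (simp add: uniform_ball_def)
  qed
  also have "\<dots> = ennreal (a powr - s)"
    by (simp add: nn_integral_multc nn_integral_uniform_ball[OF r])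
  finally show ?thesis .
qed

lemma uniform_ball_potential_ge:
  assumes r: "0 < r" and s: "0 < s" and b: "0 < b" and ge: "\<And>y. y \<in> ball c r \<Longrightarrow> norm (x - y) \<le> b"
  shows "ennreal (b powr - s) \<le> (\<integral>\<^sup>+y. ennreal (uniform_ball c r y) * riesz s x y \<partial>lborel)"
proof -
  have "ennreal (b powr - s) = (\<integral>\<^sup>+y. ennreal (uniform_ball c r y) * ennreal (b powr - s) \<partial>lborel)"
    by (simp add: nn_integral_multc nn_integral_uniform_ball[OF r])
  also have "\<dots> \<le> (\<integral>\<^sup>+y. ennreal (uniform_ball c r y) * riesz s x y \<partial>lborel)"
  proof (rule nn_integral_mono)
    fix y
    show "ennreal (uniform_ball c r y) * ennreal (b powr - s) \<le> ennreal (uniform_ball c r y) * riesz s x y"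
    proof (cases "y \<in> ball c r \<and> x \<noteq> y")
      case True
      then have "b powr - s \<le> norm (x - y) powr - s"
        using ge[of y] s by (intro powr_mono2') auto
      then show ?thesis
        using True by (intro mult_left_mono) (auto simp: riesz_eq intro!: ennreal_leI)
    next
      \<comment> \<open>Outside the ball both sides vanish; at \<open>y = x\<close> inside the ball
        the right-hand side is infinite.\<close>
      case False
      then show ?thesis
        using s by (auto simp: uniform_ball_def riesz_def ennreal_mult_top ennreal_top_mult)
    qed
  qed
  finally show ?thesis .
qed

lemma dyadic_scale_exists:
  fixes t r :: real
  assumes "0 < t" "t < r"
  shows "\<exists>n. r / 2 ^ Suc n \<le> t \<and> t < r / 2 ^ n"
proof -
  have "\<exists>n. r / t < 2 ^ n"
    by (rule real_arch_pow) simp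
  then have ex: "\<exists>n. r / 2 ^ n \<le> t"
    using assms by (auto simp: field_simps intro: less_imp_le)
  define n where "n = (LEAST n. r / 2 ^ n \<le> t)"
  have n: "r / 2 ^ n \<le> t" "\<And>m. m < n \<Longrightarrow> t < r / 2 ^ m"
    using LeastI_ex[OF ex] not_less_Least[of _ "\<lambda>n. r / 2 ^ n \<le> t"]
    unfolding n_def by (auto simp flip: not_le)
  then obtain m where "n = Suc m"
    using assms by (cases n) auto
  then show ?thesis
    using n by blast
qed

text \<open>On the shell between \<open>r / 2 ^ Suc n\<close> and \<open>r / 2 ^ n\<close> the
  kernel is at most its value at the inner radius. Enlarging the shells to balls gives sets of
  explicit volume. Distances of at least \<open>r\<close> are covered by the first term.\<close>

lemma riesz_le_dyadic:
  assumes "0 < r" "0 < s" "x \<noteq> y"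
  shows "riesz s x y \<le> ennreal (r powr - s) +
    (\<Sum>n. ennreal ((r / 2 ^ Suc n) powr - s) * indicator (ball x (r / 2 ^ n)) y)"
proof (cases "norm (x - y) < r")
  case True
  then obtain n where n: "r / 2 ^ Suc n \<le> norm (x - y)" "norm (x - y) < r / 2 ^ n"
    using dyadic_scale_exists[of "norm (x - y)" r] assms by auto
  define f where "f n = ennreal ((r / 2 ^ Suc n) powr - s) * indicator (ball x (r / 2 ^ n)) y" for n
  have "riesz s x y \<le> f n"
    using n assms by (auto simp: f_def riesz_eq dist_norm intro!: ennreal_leI powr_mono2')
  also have "\<dots> \<le> (\<Sum>n. f n)"
    using sum_le_suminf[of f "{n}"] by simp
  finally show ?thesis
    unfolding f_def by (simp add: add_increasing)
next
  case False
  then have "riesz s x y \<le> ennreal (r powr - s)"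
    using assms by (auto simp: riesz_eq intro!: ennreal_leI powr_mono2')
  then show ?thesis
    by (rule order_trans) simp
qed

text \<open>The bound is uniform in \<open>x\<close>, also for \<open>x\<close> inside the ball. The
  density is at most \<open>w\<close>, the inverse volume of the ball, and the dyadic balls around
  \<open>x\<close> contribute a geometric series with ratio
  \<open>2 powr (s - real DIM('a))\<close>, which is less than 1 because
  \<open>s < real DIM('a)\<close>. In \<open>C\<close> the summand 1 stems from distances of at
  least \<open>r\<close>, the other one from the series.\<close>

lemma uniform_ball_potential_le:
  fixes c x :: "'a::euclidean_space"
  assumes r: "0 < r" and s: "0 < s" "s < real DIM('a)"
  defines "C \<equiv> 1 + 2 powr s / (1 - 2 powr (s - real DIM('a)))"
  shows "(\<integral>\<^sup>+y. ennreal (uniform_ball c r y) * riesz s x y \<partial>lborel) \<le> ennreal (C * r powr - s)"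
proof -
  define \<beta> where "\<beta> = unit_ball_vol (real DIM('a))"
  have \<beta>: "0 < \<beta>" by (simp add: \<beta>_def)
  define z where "z = 2 powr (s - real DIM('a))"
  have z: "0 < z" "z < 1"
    using s by (auto simp: z_def powr_less_one)
  define w where "w = 1 / (\<beta> * r ^ DIM('a))"
  have w: "0 < w" using \<beta> r by (simp add: w_def)
  define g where "g n y = ennreal ((r / 2 ^ Suc n) powr - s) * indicator (ball x (r / 2 ^ n)) y" for n y
  have u: "uniform_ball c r y \<le> w" for y
    using r \<beta> by (auto simp: uniform_ball_def w_def \<beta>_def indicator_def)
  have [measurable]: "g n \<in> borel_measurable borel" for n
    unfolding g_def[abs_def]
    by measurable
  have "(\<integral>\<^sup>+y. ennreal (uniform_ball c r y) * riesz s x y \<partial>lborel) \<le>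
      (\<integral>\<^sup>+y. ennreal (uniform_ball c r y) * ennreal (r powr - s) + ennreal w * (\<Sum>n. g n y) \<partial>lborel)"
  proof (rule nn_integral_mono_AE, rule AE_mp[OF AE_lborel_singleton[of x]], intro AE_I2 impI)
    fix y assume "y \<noteq> x"
    then have "ennreal (uniform_ball c r y) * riesz s x y \<le>
        ennreal (uniform_ball c r y) * (ennreal (r powr - s) + (\<Sum>n. g n y))"
      unfolding g_def using r s by (intro mult_left_mono riesz_le_dyadic) auto
    also have "\<dots> \<le> ennreal (uniform_ball c r y) * ennreal (r powr - s) + ennreal w * (\<Sum>n. g n y)"
      unfolding distrib_left by (intro add_left_mono mult_right_mono ennreal_leI u) auto
    finally show "ennreal (uniform_ball c r y) * riesz s x y \<le>
        ennreal (uniform_ball c r y) * ennreal (r powr - s) + ennreal w * (\<Sum>n. g n y)" .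
  qed
  also have "\<dots> = ennreal (r powr - s) + ennreal w * (\<Sum>n. \<integral>\<^sup>+y. g n y \<partial>lborel)"
  proof -
    have "(\<integral>\<^sup>+y. (\<Sum>n. g n y) \<partial>lborel) = (\<Sum>n. \<integral>\<^sup>+y. g n y \<partial>lborel)"
      by (rule nn_integral_suminf) simp
    moreover have "(\<lambda>y. \<Sum>n. g n y) \<in> borel_measurable lborel"
      by measurable
    ultimately show ?thesis
      by (simp add: nn_integral_add nn_integral_multc nn_integral_cmult nn_integral_uniform_ball[OF r])
  qed
  also have "(\<Sum>n. \<integral>\<^sup>+y. g n y \<partial>lborel) = (\<Sum>n. ennreal ((r powr - s * 2 powr s / w) * z ^ n))"
  proof (rule suminf_cong)
    fix n
    have "(\<integral>\<^sup>+y. g n y \<partial>lborel) = ennreal ((r / 2 ^ Suc n) powr - s * (\<beta> * (r / 2 ^ n) ^ DIM('a)))"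
      using r unfolding g_def by (subst nn_integral_cmult_indicator) (auto simp: emeasure_ball \<beta>_def ennreal_mult)
    also have "(r / 2 ^ Suc n) powr - s * (\<beta> * (r / 2 ^ n) ^ DIM('a)) = (r powr - s * 2 powr s / w) * z ^ n"
    proof -
      have "(r / 2 ^ Suc n) powr - s = r powr - s * (2 ^ Suc n) powr s"
        using r by (simp add: powr_divide powr_minus divide_simps del: power_Suc)
      also have "(2 ^ Suc n :: real) powr s = 2 powr s * 2 powr (real n * s)"
        by (simp add: powr_mult powr_powr powr_realpow[symmetric])
      finally have 1: "(r / 2 ^ Suc n) powr - s = r powr - s * (2 powr s * 2 powr (real n * s))" .
      have 2: "(r / 2 ^ n) ^ DIM('a) = r ^ DIM('a) * 2 powr (- (real n * real DIM('a)))"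
        by (simp add: power_divide power_mult[symmetric] powr_minus powr_powr powr_realpow[symmetric] divide_simps)
      have 3: "z ^ n = 2 powr (real n * s) * 2 powr (- (real n * real DIM('a)))"
        using z by (simp add: powr_realpow[symmetric] z_def powr_powr powr_add[symmetric] algebra_simps)
      show ?thesis
        unfolding 1 2 3 using r \<beta> by (simp add: w_def)
    qed
    finally show "(\<integral>\<^sup>+y. g n y \<partial>lborel) = ennreal ((r powr - s * 2 powr s / w) * z ^ n)" .
  qed
  also have "\<dots> = ennreal ((r powr - s * 2 powr s / w) * (1 / (1 - z)))"
    using z w by (intro suminf_ennreal_eq sums_mult geometric_sums) auto
  also have "ennreal (r powr - s) + ennreal w * \<dots> = ennreal (C * r powr - s)"
  proof -
    have "r powr - s + w * (r powr - s * 2 powr s / w * (1 / (1 - z))) = C * r powr - s"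
      using w by (simp add: C_def z_def[symmetric] distrib_right)
    then show ?thesis
      using z w r by (simp add: ennreal_mult[symmetric] ennreal_plus[symmetric] del: ennreal_plus)
  qed
  finally show ?thesis .
qed

section \<open>Power inequalities and the effect of an added ball on \<open>L_fun\<close> and
  \<open>D_fun\<close>\<close>

lemma powr_add_le_add_powr:
  fixes x b q :: real
  assumes "0 \<le> x" "0 \<le> b" "0 < q" "q < 1"
  shows "(x + b) powr q \<le> x powr q + b powr q"
proof (cases "x = 0 \<or> b = 0")
  case False
  then have pos: "0 < x" "0 < b" using assms by auto
  \<comment> \<open>One factor is split off because the remaining exponent \<open>q - 1\<close> is
    negative: replacing \<open>x + b\<close> by either summand then increases the power.\<close>
  have "(x + b) powr q = x * (x + b) powr (q - 1) + b * (x + b) powr (q - 1)"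
    using pos by (simp add: powr_mult_base flip: distrib_right)
  also have "\<dots> \<le> x * x powr (q - 1) + b * b powr (q - 1)"
    using pos assms by (intro add_mono mult_left_mono powr_mono2') auto
  also have "\<dots> = x powr q + b powr q"
    using pos by (simp add: powr_mult_base)
  finally show ?thesis .
qed (use assms in auto)

text \<open>The mean value theorem, with the derivative estimated at the right end point. The
  explicit factor \<open>b\<close> makes the increment linear in the added density, up to the power
  \<open>q\<close> that the next estimates treat.\<close>

lemma powr_add_le_tangent:
  fixes x b q :: real
  assumes "0 \<le> x" "0 \<le> b" "0 < q"
  shows "(x + b) powr (1 + q) \<le> x powr (1 + q) + (1 + q) * b * (x + b) powr q"
proof (cases "x = 0 \<or> b = 0")
  case True
  then show ?thesis
    using assms by (auto simp: powr_add field_simps)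
next
  case False
  then have pos: "0 < x" "0 < b" using assms by auto
  have "\<exists>\<xi>. x < \<xi> \<and> \<xi> < x + b \<and>
      (x + b) powr (1 + q) - x powr (1 + q) = (x + b - x) * ((1 + q) * \<xi> powr q)"
    using pos by (intro MVT2) (auto intro!: derivative_eq_intros)
  then obtain \<xi> where \<xi>: "x < \<xi>" "\<xi> < x + b"
      "(x + b) powr (1 + q) - x powr (1 + q) = (1 + q) * b * \<xi> powr q" by auto
  have "(1 + q) * b * \<xi> powr q \<le> (1 + q) * b * (x + b) powr q"
    using pos \<xi> assms by (intro mult_left_mono powr_mono2) auto
  then show ?thesis
    using \<xi>(3) by linarith
qed

text \<open>Up to \<open>l\<close> the constant suffices; beyond \<open>l\<close> one has
  \<open>x powr (q - 1) \<le> l powr (q - 1)\<close>. An affine bound is wanted because only the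
  mass of a density on a ball is known, not the integral of its power \<open>q\<close>.\<close>

lemma powr_le_affine:
  fixes x l q :: real
  assumes "0 \<le> x" "0 < l" "0 < q" "q < 1"
  shows "x powr q \<le> l powr (q - 1) * x + l powr q"
proof (cases "x \<le> l")
  case True
  then have "x powr q \<le> l powr q" using assms by (intro powr_mono2) auto
  then show ?thesis using assms by (simp add: add_increasing)
next
  case False
  then have "x powr (q - 1) \<le> l powr (q - 1)" using assms by (intro powr_mono2') auto
  then have "x powr (q - 1) * x \<le> l powr (q - 1) * x" using assms by (intro mult_right_mono) auto
  moreover have "x powr q = x powr (q - 1) * x"
    using False assms by (simp add: powr_diff)
  ultimately show ?thesis by (simp add: add_increasing2)
qed

text \<open>
  The mass \<open>F\<close> of \<open>f\<close> on the ball may be small; the free parameter \<open>\<theta>\<close> trades it against the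
  term \<open>\<theta> powr q\<close> when \<open>f powr q\<close> is linearised at \<open>\<theta>\<close> times the height of the uniform density.
\<close>

lemma L_fun_add_uniform_ball_le:
  fixes f :: "'a::euclidean_space \<Rightarrow> real" and c :: 'a
  assumes [measurable]: "f \<in> borel_measurable borel" and f: "\<And>x. 0 \<le> f x"
    and r: "0 < r" and s: "0 < s" "s < real DIM('a)" and a: "0 \<le> a" and \<theta>: "0 < \<theta>"
    and F: "(\<integral>\<^sup>+x. ennreal (f x) * indicator (ball c r) x \<partial>lborel) \<le> ennreal F" "0 \<le> F"
  defines "q \<equiv> s / real DIM('a)"
  shows "L_fun s (\<lambda>x. f x + a * uniform_ball c r x) \<le> L_fun s f +
    ennreal ((1 + q) * unit_ball_vol (real DIM('a)) powr - q * r powr - s * a *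
      (\<theta> powr (q - 1) * F + \<theta> powr q + a powr q))"
proof -
  define v where "v = 1 / (unit_ball_vol (real DIM('a)) * r ^ DIM('a))"
  have v: "0 < v" using r by (simp add: v_def)
  have q: "0 < q" "q < 1" using s by (auto simp: q_def)
  let ?B = "ball c r"
  \<comment> \<open>On the ball the added density is the constant \<open>a * v\<close>. The
    coefficients arise from linearising \<open>f x powr q\<close> at \<open>\<theta> * v\<close>;
    the powers of \<open>v\<close> combine by \<open>v * v powr (q - 1) = v powr q\<close>.\<close>
  define k1 where "k1 = (1 + q) * a * v powr q * \<theta> powr (q - 1)"
  define k2 where "k2 = (1 + q) * a * v powr q * v * (\<theta> powr q + a powr q)"
  have k: "0 \<le> k1" "0 \<le> k2" using q a v by (auto simp: k1_def k2_def)
  have pt: "(f x + a * v) powr (1 + q) \<le> f x powr (1 + q) + (k1 * f x + k2)" for x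
  proof -
    have "(f x + a * v) powr q \<le> f x powr q + (a * v) powr q"
      using f[of x] a v q by (intro powr_add_le_add_powr) auto
    also have "f x powr q \<le> (\<theta> * v) powr (q - 1) * f x + (\<theta> * v) powr q"
      using f[of x] \<theta> v q by (intro powr_le_affine) auto
    finally have "(1 + q) * (a * v) * (f x + a * v) powr q \<le>
        (1 + q) * (a * v) * ((\<theta> * v) powr (q - 1) * f x + (\<theta> * v) powr q + (a * v) powr q)"
      using q a v by (intro mult_left_mono) auto
    also have "\<dots> = k1 * f x + k2"
    proof -
      have "v powr q = v * v powr (q - 1)"
        using v by (simp add: powr_mult_base)
      then show ?thesis
        using v \<theta> a by (simp add: k1_def k2_def powr_mult algebra_simps)
    qed
    finally show ?thesis
      using powr_add_le_tangent[of "f x" "a * v" q] f[of x] a v q by simp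
  qed
  have "L_fun s (\<lambda>x. f x + a * uniform_ball c r x) \<le>
      (\<integral>\<^sup>+x. ennreal (f x powr (1 + q)) + (ennreal k1 * (ennreal (f x) * indicator ?B x) +
        ennreal k2 * indicator ?B x) \<partial>lborel)"
    unfolding L_fun_def q_def[symmetric]
  proof (rule nn_integral_mono)
    fix x
    show "ennreal ((f x + a * uniform_ball c r x) powr (1 + q)) \<le> ennreal (f x powr (1 + q)) +
      (ennreal k1 * (ennreal (f x) * indicator ?B x) + ennreal k2 * indicator ?B x)"
    proof (cases "x \<in> ?B")
      case True
      then have "uniform_ball c r x = v"
        by (simp add: uniform_ball_def v_def)
      then have "ennreal ((f x + a * uniform_ball c r x) powr (1 + q)) \<le>
          ennreal (f x powr (1 + q) + (k1 * f x + k2))"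
        using pt[of x] by (simp add: ennreal_leI)
      also have "\<dots> = ennreal (f x powr (1 + q)) + (ennreal k1 * ennreal (f x) + ennreal k2)"
        using k f[of x] by (simp add: ennreal_mult)
      finally show ?thesis using True by simp
    qed (simp add: uniform_ball_def)
  qed
  also have "\<dots> = L_fun s f + (ennreal k1 * (\<integral>\<^sup>+x. ennreal (f x) * indicator ?B x \<partial>lborel) +
      ennreal k2 * emeasure lborel ?B)"
    unfolding L_fun_def q_def[symmetric]
    by (subst nn_integral_add, measurable)+ (simp add: nn_integral_cmult)
  also have "\<dots> \<le> L_fun s f + (ennreal k1 * ennreal F + ennreal k2 * ennreal (1 / v))"
    using r by (intro add_left_mono add_mono mult_left_mono F) (auto simp: emeasure_ball v_def)
  also have "ennreal k1 * ennreal F + ennreal k2 * ennreal (1 / v) = ennreal (k1 * F + k2 / v)"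
    using k v F by (simp add: ennreal_mult[symmetric] ennreal_plus[symmetric] del: ennreal_plus)
  also have "k1 * F + k2 / v = (1 + q) * v powr q * a * (\<theta> powr (q - 1) * F + \<theta> powr q + a powr q)"
    using v by (simp add: k1_def k2_def field_simps)
  \<comment> \<open>Here the exponent \<open>1 + s / d\<close> matters: \<open>v\<close> is of order
    \<open>r\<close> to the power \<open>-d\<close>, so \<open>v powr q\<close> scales like
    \<open>r powr - s\<close>, exactly as the interaction does.\<close>
  also have "v powr q = unit_ball_vol (real DIM('a)) powr - q * r powr - s"
  proof -
    have "(r ^ DIM('a)) powr q = r powr s"
      using r by (simp add: powr_realpow[symmetric] powr_powr q_def)
    then show ?thesis
      using r by (simp add: v_def powr_divide powr_mult powr_minus divide_simps)
  qed
  finally show ?thesis by (simp add: mult.assoc)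
qed

lemma L_fun_mono:
  assumes "0 \<le> s" "\<And>x. 0 \<le> f x" "\<And>x. f x \<le> g x"
  shows "L_fun s f \<le> L_fun s g"
  unfolding L_fun_def using assms by (intro nn_integral_mono ennreal_leI powr_mono2) auto

text \<open>The nonnegative self-interaction of \<open>g\<close> is dropped. The two cross terms
  agree by Tonelli and the symmetry of the kernel, whence the factor 2.\<close>

lemma D_fun_add_ge:
  fixes f g :: "'a::euclidean_space \<Rightarrow> real"
  assumes [measurable]: "f \<in> borel_measurable borel" "g \<in> borel_measurable borel"
    and f: "\<And>x. 0 \<le> f x" and g: "\<And>x. 0 \<le> g x"
  shows "D_fun s f + 2 * (\<integral>\<^sup>+x. ennreal (f x) * (\<integral>\<^sup>+y. ennreal (g y) * riesz s x y \<partial>lborel) \<partial>lborel)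
    \<le> D_fun s (\<lambda>x. f x + g x)"
proof -
  let ?I = "\<lambda>f g. \<integral>\<^sup>+x. \<integral>\<^sup>+y. ennreal (f x) * ennreal (g y) * riesz s x y \<partial>lborel \<partial>lborel"
  have *: "?I f g = (\<integral>\<^sup>+x. ennreal (f x) * (\<integral>\<^sup>+y. ennreal (g y) * riesz s x y \<partial>lborel) \<partial>lborel)"
    by (auto simp: mult.assoc nn_integral_cmult)
  have "?I g f = ?I f g"
    by (subst lborel_pair.Fubini'[symmetric]) (auto simp: riesz_commute mult_ac intro!: nn_integral_cong)
  then have "D_fun s f + 2 * ?I f g = ?I f f + ?I f g + ?I g f"
    by (simp add: D_fun_def mult_2 add.assoc)
  also have "\<dots> = (\<integral>\<^sup>+x. \<integral>\<^sup>+y. ennreal (f x) * ennreal (f y) * riesz s x y +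
      ennreal (f x) * ennreal (g y) * riesz s x y + ennreal (g x) * ennreal (f y) * riesz s x y
      \<partial>lborel \<partial>lborel)"
    by (simp add: nn_integral_add)
  also have "\<dots> \<le> D_fun s (\<lambda>x. f x + g x)"
    unfolding D_fun_def
  proof (intro nn_integral_mono)
    fix x y
    show "ennreal (f x) * ennreal (f y) * riesz s x y + ennreal (f x) * ennreal (g y) * riesz s x y +
        ennreal (g x) * ennreal (f y) * riesz s x y \<le> ennreal (f x + g x) * ennreal (f y + g y) * riesz s x y"
      using f g by (simp add: algebra_simps)
  qed
  finally show ?thesis by (simp add: *)
qed

section \<open>Perturbing a grand-canonical probability\<close>

text \<open>The vacuum is a point mass on the one-point space of configurations without particles.\<close>

definition gc_sector :: "'a::euclidean_space grand_canonical \<Rightarrow> nat \<Rightarrow> (nat \<Rightarrow> 'a) measure" where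
  "gc_sector \<Gamma> k = (if k = 0 then scale_measure (ennreal (vacuum \<Gamma>)) (config 0) else sector \<Gamma> k)"

definition number_prob :: "'a::euclidean_space grand_canonical \<Rightarrow> nat \<Rightarrow> real" where
  "number_prob \<Gamma> k = (if k = 0 then vacuum \<Gamma> else mass (sector \<Gamma> k))"

lemma emeasure_one_body_scale:
  assumes Q: "sets Q = sets (config k)" and A: "A \<in> sets borel"
  shows "emeasure (one_body k (scale_measure c Q)) A = c * emeasure (one_body k Q) A"
proof -
  have [measurable]: "(\<lambda>x. \<Sum>i<k. indicator A (x i) :: ennreal) \<in> borel_measurable Q"
    unfolding measurable_cong_sets[OF Q refl] using A by measurable
  have "(\<integral>\<^sup>+y. indicator A y \<partial>one_body k (scale_measure c Q)) = c * (\<integral>\<^sup>+y. indicator A y \<partial>one_body k Q)"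
    using A Q by (simp add: nn_integral_one_body nn_integral_scale_measure del: nn_integral_indicator)
  then show ?thesis
    using A by simp
qed

lemma pair_energy_scale:
  assumes Q: "sets Q = sets (config k)"
  shows "pair_energy s k (scale_measure c Q) = c * pair_energy s k Q"
proof -
  have [measurable]: "(\<lambda>x. \<Sum>j<k. \<Sum>i<j. riesz s (x i) (x j)) \<in> borel_measurable Q"
    unfolding measurable_cong_sets[OF Q refl] by measurable
  show ?thesis
    unfolding pair_energy_def by (simp add: nn_integral_scale_measure)
qed

context
  fixes N :: nat and \<Gamma> :: "'a::euclidean_space grand_canonical"
  assumes gc: "truncated_gc N \<Gamma>"
begin

lemma sets_gc_sector: "k \<le> N \<Longrightarrow> sets (gc_sector \<Gamma> k) = sets (config k)"
  using gc by (auto simp: truncated_gc_def gc_sector_def symmetric_measure_def)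

lemma number_prob_nonneg: "0 \<le> number_prob \<Gamma> k"
  using gc by (auto simp: truncated_gc_def number_prob_def mass_def)

lemma emeasure_space_gc_sector:
  assumes "k \<le> N"
  shows "emeasure (gc_sector \<Gamma> k) (space (gc_sector \<Gamma> k)) = ennreal (number_prob \<Gamma> k)"
proof (cases "k = 0")
  case True
  then show ?thesis
    by (simp add: gc_sector_def number_prob_def space_scale_measure PiM_empty)
next
  case False
  then have "finite_measure (sector \<Gamma> k)"
    using gc assms by (auto simp: truncated_gc_def)
  then show ?thesis
    using False by (simp add: gc_sector_def number_prob_def mass_def finite_measure.emeasure_eq_measure)
qed

lemma finite_gc_sector: "k \<le> N \<Longrightarrow> finite_measure (gc_sector \<Gamma> k)"
  by (intro finite_measureI) (simp add: emeasure_space_gc_sector)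

lemma sum_number_prob: "(\<Sum>k\<le>N. number_prob \<Gamma> k) = 1"
proof -
  have "(\<Sum>k\<le>N. number_prob \<Gamma> k) = number_prob \<Gamma> 0 + (\<Sum>k=1..N. mass (sector \<Gamma> k))"
    by (simp add: atMost_atLeast0 sum.atLeast_Suc_atMost) (simp add: number_prob_def)
  also have "\<dots> = 1"
    using gc by (simp add: truncated_gc_def number_prob_def)
  finally show ?thesis .
qed

lemma emeasure_gc_one_body:
  assumes "A \<in> sets borel"
  shows "emeasure (gc_one_body N \<Gamma>) A = (\<Sum>k\<le>N. emeasure (one_body k (gc_sector \<Gamma> k)) A)"
proof -
  have 0: "emeasure (one_body 0 (gc_sector \<Gamma> 0)) A = 0"
    using assms by (simp add: one_body_def sum_measures_eq_measure_sum emeasure_measure_sum)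
  have "emeasure (gc_one_body N \<Gamma>) A = (\<Sum>k=1..N. emeasure (one_body k (sector \<Gamma> k)) A)"
    unfolding gc_one_body_def sum_measures_eq_measure_sum using assms by (intro emeasure_measure_sum) auto
  also have "\<dots> = (\<Sum>k\<le>N. emeasure (one_body k (gc_sector \<Gamma> k)) A)"
    by (simp add: atMost_atLeast0 sum.atLeast_Suc_atMost 0) (auto simp: gc_sector_def intro!: sum.cong)
  finally show ?thesis .
qed

lemma gc_W_eq: "gc_W s N \<Gamma> = (\<Sum>k\<le>N. pair_energy s k (gc_sector \<Gamma> k))"
  unfolding gc_W_def
proof (rule sum.mono_neutral_cong_left)
  show "\<forall>k\<in>{..N} - {2..N}. pair_energy s k (gc_sector \<Gamma> k) = 0"
  proof
    fix k assume "k \<in> {..N} - {2..N}"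
    then have "k = 0 \<or> k = 1" by auto
    then show "pair_energy s k (gc_sector \<Gamma> k) = 0"
      by (auto simp: pair_energy_def)
  qed
qed (auto simp: gc_sector_def)

lemma expectation_number_law:
  "(\<integral>k. f k \<partial>number_law N \<Gamma>) = (\<Sum>k\<le>N. number_prob \<Gamma> k * (f k :: real))"
  using number_prob_nonneg
  by (simp add: number_law_def lebesgue_integral_point_measure_finite atMost_atLeast0
      flip: number_prob_def)

text \<open>Mass, one-body measure and energy are all additive over the components, so splitting
  sector \<open>k\<close> requires the same bookkeeping three times: \<open>a i\<close> is the value
  on sector \<open>i\<close>, and \<open>x\<close> is what the extra particle contributes. The part
  that was split off sits at index \<open>Suc N\<close>.\<close>

lemma sum_with_split_sector:
  fixes a :: "nat \<Rightarrow> ennreal"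
  assumes "k \<le> N" "0 \<le> \<epsilon>" "\<epsilon> \<le> 1"
  shows "(\<Sum>i\<le>Suc N. if i = k then ennreal (1 - \<epsilon>) * a k else if i \<le> N then a i else ennreal \<epsilon> * (a k + x))
    = (\<Sum>i\<le>N. a i) + ennreal \<epsilon> * x"
proof -
  have one: "ennreal (1 - \<epsilon>) + ennreal \<epsilon> = 1"
    using assms by (simp flip: ennreal_plus)
  have "(\<Sum>i\<le>N. if i = k then ennreal (1 - \<epsilon>) * a k else if i \<le> N then a i else ennreal \<epsilon> * (a k + x))
      = ennreal (1 - \<epsilon>) * a k + (\<Sum>i\<in>{..N} - {k}. a i)"
    using assms by (subst sum.remove[of _ k]) (auto intro!: sum.cong)
  moreover have "(\<Sum>i\<le>N. a i) = (ennreal (1 - \<epsilon>) + ennreal \<epsilon>) * a k + (\<Sum>i\<in>{..N} - {k}. a i)"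
    unfolding one using assms by (subst sum.remove[of _ k]) auto
  ultimately show ?thesis
    using assms by (simp add: distrib_left distrib_right ac_simps)
qed

text \<open>
  Apply \<open>canonical_from_mixture\<close> to the sectors of \<open>\<Gamma>\<close>, where sector \<open>k\<close> is split: with weight \<open>1 - \<epsilon>\<close> it stays
  as it is, with weight \<open>\<epsilon>\<close> it first receives a particle with law \<open>\<tau>\<close> (index \<open>Suc N\<close>).
\<close>

lemma canonical_from_gc:
  fixes \<tau> \<sigma> :: "'a measure"
  assumes k: "k < N" and \<epsilon>: "0 \<le> \<epsilon>" "\<epsilon> \<le> 1"
    and \<tau>: "sets \<tau> = sets borel" "prob_space \<tau>"
    and \<sigma>: "sets \<sigma> = sets borel" "prob_space \<sigma>"
    and v: "\<And>x. (\<integral>\<^sup>+y. riesz s x y \<partial>\<sigma>) \<le> v"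
  obtains P c where "prob_space P" "symmetric_measure N P"
    "\<And>A. A \<in> sets borel \<Longrightarrow> emeasure (one_body N P) A =
      emeasure (gc_one_body N \<Gamma>) A + ennreal (\<epsilon> * number_prob \<Gamma> k) * emeasure \<tau> A + c * emeasure \<sigma> A"
    "pair_energy s N P \<le> gc_W s N \<Gamma> +
      ennreal \<epsilon> * (\<integral>\<^sup>+x. (\<integral>\<^sup>+y. riesz s x y \<partial>\<tau>) \<partial>one_body k (gc_sector \<Gamma> k)) + of_nat (N * N) * v"
proof -
  let ?S = "gc_sector \<Gamma>"
  \<comment> \<open>The component at index \<open>Suc N\<close> has \<open>Suc k\<close> particles,
    which is at most \<open>N\<close> since \<open>k < N\<close>.\<close>
  define n where "n i = (if i \<le> N then i else Suc k)" for i
  define T where "T = append_particle k (?S k) \<tau>"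
  define Q where "Q i = (if i = k then scale_measure (ennreal (1 - \<epsilon>)) (?S k)
    else if i \<le> N then ?S i else scale_measure (ennreal \<epsilon>) T)" for i
  have Sk: "sets (?S k) = sets (config k)" "finite_measure (?S k)"
    using k by (auto simp: sets_gc_sector finite_gc_sector)
  have T: "sets T = sets (config (Suc k))" "finite_measure T"
    "emeasure T (space T) = ennreal (number_prob \<Gamma> k)"
    using k Sk \<tau> by (auto simp: T_def finite_append_particle emeasure_space_append_particle
        emeasure_space_gc_sector)
  have scale: "finite_measure (scale_measure (ennreal c) M)" if "finite_measure M"
    for c :: real and M :: "(nat \<Rightarrow> 'a) measure"
    using finite_measure.emeasure_finite[OF that]
    by (intro finite_measureI) (simp add: space_scale_measure ennreal_mult_eq_top_iff)
  \<comment> \<open>An extra particle does not change the mass; the summand 0 brings the expression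
    into the form of \<open>sum_with_split_sector\<close>.\<close>
  have emQ: "emeasure (Q i) (space (Q i)) = (if i = k then ennreal (1 - \<epsilon>) * ennreal (number_prob \<Gamma> k)
      else if i \<le> N then ennreal (number_prob \<Gamma> i) else ennreal \<epsilon> * (ennreal (number_prob \<Gamma> k) + 0))" for i
    using k by (simp add: Q_def space_scale_measure emeasure_space_gc_sector T)
  have massQ: "(\<Sum>i\<le>Suc N. emeasure (Q i) (space (Q i))) = 1"
    unfolding emQ using k \<epsilon> sum_number_prob number_prob_nonneg
    by (subst sum_with_split_sector) (auto simp: sum_ennreal)
  have bodyQ: "(\<Sum>i\<le>Suc N. emeasure (one_body (n i) (Q i)) A) =
      emeasure (gc_one_body N \<Gamma>) A + ennreal (\<epsilon> * number_prob \<Gamma> k) * emeasure \<tau> A"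
    if A: "A \<in> sets borel" for A
  proof -
    have "emeasure (one_body (Suc k) T) A =
        emeasure (one_body k (?S k)) A + ennreal (number_prob \<Gamma> k) * emeasure \<tau> A"
      using one_body_append_particle[OF Sk \<tau>, of "indicator A"] A k \<tau>
      by (simp add: T_def emeasure_space_gc_sector)
    then have "emeasure (one_body (n i) (Q i)) A =
      (if i = k then ennreal (1 - \<epsilon>) * emeasure (one_body k (?S k)) A
       else if i \<le> N then emeasure (one_body i (?S i)) A
       else ennreal \<epsilon> * (emeasure (one_body k (?S k)) A + ennreal (number_prob \<Gamma> k) * emeasure \<tau> A))" for i
      using k A by (simp add: n_def Q_def emeasure_one_body_scale Sk T)
    then show ?thesis
      using k \<epsilon> A number_prob_nonneg
        sum_with_split_sector[where k=k and \<epsilon>=\<epsilon> and a="\<lambda>i. emeasure (one_body i (?S i)) A"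
          and x="ennreal (number_prob \<Gamma> k) * emeasure \<tau> A"]
      by (simp add: emeasure_gc_one_body ennreal_mult mult.assoc del: sum.atMost_Suc)
  qed
  have energyQ: "(\<Sum>i\<le>Suc N. pair_energy s (n i) (Q i)) = gc_W s N \<Gamma> +
      ennreal \<epsilon> * (\<integral>\<^sup>+x. (\<integral>\<^sup>+y. riesz s x y \<partial>\<tau>) \<partial>one_body k (?S k))"
  proof -
    have "pair_energy s (n i) (Q i) =
      (if i = k then ennreal (1 - \<epsilon>) * pair_energy s k (?S k)
       else if i \<le> N then pair_energy s i (?S i)
       else ennreal \<epsilon> * (pair_energy s k (?S k) + (\<integral>\<^sup>+x. (\<integral>\<^sup>+y. riesz s x y \<partial>\<tau>) \<partial>one_body k (?S k))))" for i
      using k pair_energy_append_particle[OF Sk \<tau>, of s]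
      by (simp add: n_def Q_def pair_energy_scale Sk T) (simp add: T_def)
    then show ?thesis
      using k \<epsilon>
        sum_with_split_sector[where k=k and \<epsilon>=\<epsilon> and a="\<lambda>i. pair_energy s i (?S i)"
          and x="\<integral>\<^sup>+x. (\<integral>\<^sup>+y. riesz s x y \<partial>\<tau>) \<partial>one_body k (?S k)"]
      by (simp add: gc_W_eq del: sum.atMost_Suc)
  qed
  obtain P where P: "prob_space P" "symmetric_measure N P"
    "\<And>A. A \<in> sets borel \<Longrightarrow> emeasure (one_body N P) A =
      (\<Sum>i\<le>Suc N. emeasure (one_body (n i) (Q i)) A) +
      (\<Sum>i\<le>Suc N. of_nat (N - n i) * emeasure (Q i) (space (Q i))) * emeasure \<sigma> A"
    "pair_energy s N P \<le> (\<Sum>i\<le>Suc N. pair_energy s (n i) (Q i)) + of_nat (N * N) * v"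
  proof (rule canonical_from_mixture[of "{..Suc N}" Q n N \<sigma> s v])
    fix i assume "i \<in> {..Suc N}"
    show "sets (Q i) = sets (config (n i))"
      using k by (auto simp: Q_def n_def Sk T sets_gc_sector)
    show "finite_measure (Q i)"
      using k by (auto simp: Q_def Sk T finite_gc_sector intro!: scale)
    show "n i \<le> N"
      using k by (auto simp: n_def)
  qed (use massQ \<sigma> v in auto)
  show ?thesis
    by (rule that[OF P(1,2)]) (use P(3,4) bodyQ energyQ in \<open>auto simp del: sum.atMost_Suc\<close>)
qed

end

section \<open>Competitors for the supremum and the inequality that they imply\<close>

context
  fixes s :: real and N :: nat and \<Gamma> :: "'a::euclidean_space grand_canonical" and \<rho> :: "'a \<Rightarrow> real"
    and D W L :: real
  assumes s: "0 < s" "s < real DIM('a)"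
    and gc: "truncated_gc N \<Gamma>"
    and meas [measurable]: "\<rho> \<in> borel_measurable borel" and nonneg: "\<And>x. 0 \<le> \<rho> x"
    and body: "gc_one_body N \<Gamma> = density lborel (\<lambda>x. ennreal (\<rho> x))"
    and D: "D_fun s \<rho> = ennreal D" "0 \<le> D"
    and W: "gc_W s N \<Gamma> = ennreal W" "0 \<le> W"
    and L: "L_fun s \<rho> = ennreal L" "0 < L"
begin

text \<open>\<open>X\<close> bounds from below the interaction of the new particle with the whole
  density, \<open>Y\<close> bounds from above its interaction with sector \<open>k\<close> alone,
  and \<open>E\<close> bounds the growth of \<open>L_fun\<close> that it causes. The wide ball of
  radius \<open>A\<close> adds only errors of order \<open>A powr - s\<close>.\<close>

lemma perturbed_density:
  fixes k :: nat and \<epsilon> r A X Y E :: real and c :: 'a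
  defines "\<delta> \<equiv> \<epsilon> * number_prob \<Gamma> k"
    and "q \<equiv> s / real DIM('a)"
    and "C \<equiv> 1 + 2 powr s / (1 - 2 powr (s - real DIM('a)))"
  assumes k: "k < N" and \<epsilon>: "0 \<le> \<epsilon>" "\<epsilon> \<le> 1" and r: "0 < r" and A: "0 < A"
    and X: "0 \<le> X" "ennreal X \<le> (\<integral>\<^sup>+x. ennreal (\<rho> x) * (\<integral>\<^sup>+y. ennreal (uniform_ball c r y) * riesz s x y \<partial>lborel) \<partial>lborel)"
    and Y: "0 \<le> Y" "(\<integral>\<^sup>+x. (\<integral>\<^sup>+y. ennreal (uniform_ball c r y) * riesz s x y \<partial>lborel)
        \<partial>one_body k (gc_sector \<Gamma> k)) \<le> ennreal Y"
    and E: "0 \<le> E" "L_fun s (\<lambda>x. \<rho> x + \<delta> * uniform_ball c r x) \<le> ennreal (L + E)"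
  obtains \<rho>' :: "'a \<Rightarrow> real" and l where "\<rho>' \<in> densities s N" "L_fun s \<rho>' = ennreal l" "L \<le> l"
    "l \<le> L + E + (1 + q) * unit_ball_vol (real DIM('a)) powr - q * A powr - s * real N * (real N + 1 + real N powr q)"
    "ereal (D / 2 + \<delta> * X - W - \<epsilon> * Y - real (N * N) * (C * A powr - s)) \<le> G_N s N \<rho>'"
proof -
  let ?t = "uniform_ball c r" and ?u = "uniform_ball (0::'a) A"
  let ?\<tau> = "density lborel (\<lambda>y. ennreal (?t y))" and ?\<sigma> = "density lborel (\<lambda>y. ennreal (?u y))"
  have q: "0 < q" using s by (simp add: q_def)
  have C: "0 \<le> C"
    using s by (auto simp: C_def powr_less_one less_imp_le intro!: add_nonneg_nonneg divide_nonneg_nonneg)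
  have \<delta>: "0 \<le> \<delta>" using \<epsilon> number_prob_nonneg[OF gc] by (simp add: \<delta>_def)
  have t: "0 \<le> ?t x" and u: "0 \<le> ?u x" for x
    using r A by (auto intro: uniform_ball_nonneg)
  have v: "(\<integral>\<^sup>+y. riesz s x y \<partial>?\<sigma>) \<le> ennreal (C * A powr - s)" for x :: 'a
    unfolding C_def using uniform_ball_potential_le[OF A s, of 0 x] by (simp add: nn_integral_density)
  obtain P c' where P: "prob_space P" "symmetric_measure N P"
    "\<And>B. B \<in> sets borel \<Longrightarrow> emeasure (one_body N P) B =
      emeasure (gc_one_body N \<Gamma>) B + ennreal (\<epsilon> * number_prob \<Gamma> k) * emeasure ?\<tau> B + c' * emeasure ?\<sigma> B"
    "pair_energy s N P \<le> gc_W s N \<Gamma> +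
      ennreal \<epsilon> * (\<integral>\<^sup>+x. (\<integral>\<^sup>+y. riesz s x y \<partial>?\<tau>) \<partial>one_body k (gc_sector \<Gamma> k)) +
      of_nat (N * N) * ennreal (C * A powr - s)"
    by (rule canonical_from_gc[OF gc k \<epsilon> _ prob_space_uniform_ball[OF r] _ prob_space_uniform_ball[OF A] v])
      auto
  interpret P: prob_space P by (rule P(1))
  have bodyP: "emeasure (one_body N P) B = emeasure (density lborel (\<lambda>x. ennreal (\<rho> x))) B +
      ennreal \<delta> * emeasure ?\<tau> B + c' * emeasure ?\<sigma> B" if "B \<in> sets borel" for B
    using P(3)[OF that] by (simp add: body \<delta>_def)
  \<comment> \<open>The weight \<open>c'\<close> of the wide ball was left open; comparing total
    masses shows that it is finite and at most \<open>N\<close>.\<close>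
  have total: "of_nat N = (\<integral>\<^sup>+x. ennreal (\<rho> x) \<partial>lborel) + ennreal \<delta> + c'"
  proof -
    have "emeasure (one_body N P) UNIV = of_nat N"
      using P(2) by (subst emeasure_one_body_UNIV) (auto simp: symmetric_measure_def P.emeasure_space_1)
    then show ?thesis
      using bodyP[of UNIV] by (simp add: emeasure_density nn_integral_uniform_ball r A)
  qed
  have "c' \<le> of_nat N"
    unfolding total by simp
  then have "c' < top"
    using of_nat_less_top le_less_trans by blast
  then obtain a where a: "c' = ennreal a" "0 \<le> a"
    by (cases c') auto
  have aN: "a \<le> real N"
    using \<open>c' \<le> of_nat N\<close> a by (simp add: ennreal_of_nat_eq_real_of_nat)
  define \<rho>' where "\<rho>' x = (\<rho> x + \<delta> * ?t x) + a * ?u x" for x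
  have \<rho>'_nonneg: "0 \<le> \<rho>' x" for x
    using nonneg[of x] \<delta> t[of x] a u[of x] by (simp add: \<rho>'_def)
  have \<rho>'_meas [measurable]: "\<rho>' \<in> borel_measurable borel"
    unfolding \<rho>'_def[abs_def] by measurable
  have \<rho>'_ennreal: "ennreal (\<rho>' x) = ennreal (\<rho> x) + ennreal \<delta> * ennreal (?t x) + ennreal a * ennreal (?u x)" for x
    using nonneg[of x] \<delta> t[of x] a u[of x] by (simp add: \<rho>'_def ennreal_mult)
  have dens: "one_body N P = density lborel (\<lambda>x. ennreal (\<rho>' x))"
  proof (rule measure_eqI)
    fix B assume "B \<in> sets (one_body N P)"
    then have [measurable]: "B \<in> sets borel" by simp
    show "emeasure (one_body N P) B = emeasure (density lborel (\<lambda>x. ennreal (\<rho>' x))) B"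
      by (simp add: bodyP emeasure_density \<rho>'_ennreal distrib_right nn_integral_add nn_integral_cmult a mult.assoc)
  qed simp
  have int': "(\<integral>\<^sup>+x. ennreal (\<rho>' x) \<partial>lborel) = ennreal (real N)"
    using dens emeasure_density[of "\<lambda>x. ennreal (\<rho>' x)" lborel UNIV] total a
    by (simp add: \<rho>'_ennreal nn_integral_add nn_integral_cmult nn_integral_uniform_ball r A
        ennreal_of_nat_eq_real_of_nat)
  have integrable: "integrable lborel \<rho>'"
    using int' \<rho>'_nonneg by (intro integrableI_nonneg) auto
  have integral: "(\<integral>x. \<rho>' x \<partial>lborel) = real N"
    using int' \<rho>'_nonneg by (intro integral_eq_nn_integral[THEN trans]) auto
  \<comment> \<open>For the wide ball no finer trade-off is attempted: \<open>\<theta> = 1\<close>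
    and the trivial mass bound \<open>N\<close> already give an error of order
    \<open>A powr - s\<close>.\<close>
  have L1: "L_fun s \<rho>' \<le> L_fun s (\<lambda>x. \<rho> x + \<delta> * ?t x) +
      ennreal ((1 + q) * unit_ball_vol (real DIM('a)) powr - q * A powr - s * a *
      (1 powr (q - 1) * real N + 1 powr q + a powr q))"
    unfolding \<rho>'_def[abs_def] q_def
  proof (rule L_fun_add_uniform_ball_le)
    have "(\<integral>\<^sup>+x. ennreal (\<rho> x + \<delta> * ?t x) * indicator (ball 0 A) x \<partial>lborel) \<le>
        (\<integral>\<^sup>+x. ennreal (\<rho>' x) \<partial>lborel)"
      using a u by (intro nn_integral_mono) (auto simp: \<rho>'_def indicator_def intro!: ennreal_leI)
    then show "(\<integral>\<^sup>+x. ennreal (\<rho> x + \<delta> * ?t x) * indicator (ball 0 A) x \<partial>lborel) \<le> ennreal (real N)"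
      by (simp add: int')
  qed (use A s a nonneg \<delta> t in auto)
  let ?K = "(1 + q) * unit_ball_vol (real DIM('a)) powr - q * A powr - s"
  have "a * (real N + 1 + a powr q) \<le> real N * (real N + 1 + real N powr q)"
    using a aN q by (intro mult_mono add_mono powr_mono2) auto
  then have "?K * a * (real N + 1 + a powr q) \<le> ?K * real N * (real N + 1 + real N powr q)"
    using q unfolding mult.assoc by (intro mult_left_mono) auto
  then have "L_fun s \<rho>' \<le>
      ennreal (L + E) + ennreal (?K * real N * (real N + 1 + real N powr q))"
    by (intro order_trans[OF L1] add_mono E ennreal_leI) simp
  also have "\<dots> = ennreal (L + E + ?K * real N * (real N + 1 + real N powr q))"
    using q E L by (intro ennreal_plus[symmetric] mult_nonneg_nonneg add_nonneg_nonneg) auto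
  finally have L2: "L_fun s \<rho>' \<le> ennreal (L + E + ?K * real N * (real N + 1 + real N powr q))" .
  then have "L_fun s \<rho>' < top"
    using ennreal_less_top le_less_trans by blast
  then obtain l where l: "L_fun s \<rho>' = ennreal l" "0 \<le> l"
    by (cases "L_fun s \<rho>'") auto
  have "L_fun s \<rho> \<le> L_fun s \<rho>'"
    using s nonneg \<delta> t a u by (intro L_fun_mono) (auto simp: \<rho>'_def)
  then have Ll: "L \<le> l"
    using l by (simp add: L)
  have lL: "l \<le> L + E + ?K * real N * (real N + 1 + real N powr q)"
  proof -
    have "0 \<le> L + E + ?K * real N * (real N + 1 + real N powr q)"
      using L E q by (intro add_nonneg_nonneg mult_nonneg_nonneg) auto
    then show ?thesis
      using L2 unfolding l by (subst (asm) ennreal_le_iff)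
  qed
  have "W_N s N \<rho>' \<le> pair_energy s N P"
    unfolding W_N_def using P dens by (intro INF_lower) auto
  also have "\<dots> \<le> ennreal W + ennreal \<epsilon> * ennreal Y + of_nat (N * N) * ennreal (C * A powr - s)"
    using Y(2) W(1) by (intro order_trans[OF P(4)] add_mono mult_left_mono) (auto simp: nn_integral_density)
  also have "\<dots> = ennreal (W + \<epsilon> * Y + real (N * N) * (C * A powr - s))"
    using W \<epsilon> Y C by (simp add: ennreal_mult ennreal_of_nat_eq_real_of_nat)
  finally have W': "W_N s N \<rho>' \<le> \<dots>" .
  \<comment> \<open>The wide ball also interacts with \<open>\<rho>\<close>, but this only increases
    \<open>D_fun\<close> and is discarded.\<close>
  have "ennreal D + 2 * (ennreal \<delta> * ennreal X) \<le> D_fun s \<rho> +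
      2 * (\<integral>\<^sup>+x. ennreal (\<rho> x) * (\<integral>\<^sup>+y. ennreal (\<delta> * ?t y + a * ?u y) * riesz s x y \<partial>lborel) \<partial>lborel)"
  proof (intro add_mono mult_left_mono)
    have "ennreal \<delta> * ennreal X \<le> ennreal \<delta> * (\<integral>\<^sup>+x. ennreal (\<rho> x) *
        (\<integral>\<^sup>+y. ennreal (?t y) * riesz s x y \<partial>lborel) \<partial>lborel)"
      by (intro mult_left_mono X(2)) auto
    also have "\<dots> = (\<integral>\<^sup>+x. ennreal (\<rho> x) * (\<integral>\<^sup>+y. ennreal \<delta> * (ennreal (?t y) * riesz s x y) \<partial>lborel) \<partial>lborel)"
      by (simp add: nn_integral_cmult mult.left_commute flip: nn_integral_cmult)
    also have "\<dots> \<le> (\<integral>\<^sup>+x. ennreal (\<rho> x) * (\<integral>\<^sup>+y. ennreal (\<delta> * ?t y + a * ?u y) * riesz s x y \<partial>lborel) \<partial>lborel)"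
      using \<delta> t a u
      by (intro nn_integral_mono mult_left_mono) (auto simp: ennreal_mult distrib_right mult.assoc)
    finally show "ennreal \<delta> * ennreal X \<le> \<dots>" .
  qed (use D in auto)
  also have "\<dots> \<le> D_fun s (\<lambda>x. \<rho> x + (\<delta> * ?t x + a * ?u x))"
    using nonneg \<delta> t a u by (intro D_fun_add_ge) auto
  also have "(\<lambda>x. \<rho> x + (\<delta> * ?t x + a * ?u x)) = \<rho>'"
    by (simp add: \<rho>'_def fun_eq_iff)
  also have "ennreal D + 2 * (ennreal \<delta> * ennreal X) = ennreal (D + 2 * (\<delta> * X))"
    using D \<delta> X by (simp add: ennreal_mult)
  finally have D': "ennreal (D + 2 * (\<delta> * X)) \<le> D_fun s \<rho>'" .
  have D'': "ereal (D + 2 * (\<delta> * X)) \<le> enn2ereal (D_fun s \<rho>')"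
    using D' D \<delta> X by (simp add: less_eq_ennreal.rep_eq enn2ereal_ennreal del: ennreal_plus)
  have W'': "enn2ereal (W_N s N \<rho>') \<le> ereal (W + \<epsilon> * Y + real (N * N) * (C * A powr - s))"
  proof -
    have "0 \<le> W + \<epsilon> * Y + real (N * N) * (C * A powr - s)"
      using W \<epsilon> Y C by (intro add_nonneg_nonneg mult_nonneg_nonneg) auto
    then show ?thesis
      using W' by (simp add: less_eq_ennreal.rep_eq enn2ereal_ennreal)
  qed
  have "ereal (D / 2 + \<delta> * X - W - \<epsilon> * Y - real (N * N) * (C * A powr - s)) =
      ereal (D + 2 * (\<delta> * X)) / 2 - ereal (W + \<epsilon> * Y + real (N * N) * (C * A powr - s))"
    by (simp add: field_simps)
  also have "\<dots> \<le> G_N s N \<rho>'"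
    unfolding G_N_def using D'' W'' by (intro ereal_minus_mono ereal_divide_right_mono) auto
  finally have G: "ereal (D / 2 + \<delta> * X - W - \<epsilon> * Y - real (N * N) * (C * A powr - s)) \<le> G_N s N \<rho>'" .
  have "\<rho>' \<in> densities s N"
    using integrable integral \<rho>'_nonneg \<open>L_fun s \<rho>' < top\<close>
    by (simp add: densities_def nonneg_L1_Lp_def)
  from that[OF this l(1) Ll lL G] show ?thesis .
qed

text \<open>The competitor satisfies \<open>g \<le> \<Lambda> * l\<close>, and the assumption gives
  \<open>\<Lambda> * L \<le> D / 2 - W\<close>. Subtracting removes the unperturbed terms and leaves
  the gain against \<open>\<Lambda> * (l - L)\<close>. The errors of the wide ball are collected in
  \<open>M * A powr - s\<close>, which vanishes as \<open>A\<close> tends to infinity.\<close>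

lemma perturbation_inequality:
  fixes k :: nat and \<epsilon> r X Y E :: real and c :: 'a
  defines "\<delta> \<equiv> \<epsilon> * number_prob \<Gamma> k"
  assumes le: "Lambda_N TYPE('a) s N \<le> ereal ((D / 2 - W) / L)"
    and k: "k < N" and \<epsilon>: "0 \<le> \<epsilon>" "\<epsilon> \<le> 1" and r: "0 < r"
    and X: "0 \<le> X" "ennreal X \<le> (\<integral>\<^sup>+x. ennreal (\<rho> x) * (\<integral>\<^sup>+y. ennreal (uniform_ball c r y) * riesz s x y \<partial>lborel) \<partial>lborel)"
    and Y: "0 \<le> Y" "(\<integral>\<^sup>+x. (\<integral>\<^sup>+y. ennreal (uniform_ball c r y) * riesz s x y \<partial>lborel)
        \<partial>one_body k (gc_sector \<Gamma> k)) \<le> ennreal Y"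
    and E: "0 \<le> E" "L_fun s (\<lambda>x. \<rho> x + \<delta> * uniform_ball c r x) \<le> ennreal (L + E)"
  shows "\<delta> * X - \<epsilon> * Y \<le> max 0 (real_of_ereal (Lambda_N TYPE('a) s N)) * E"
proof -
  define q where "q = s / real DIM('a)"
  define C where "C = 1 + 2 powr s / (1 - 2 powr (s - real DIM('a)))"
  define \<Lambda> where "\<Lambda> = real_of_ereal (Lambda_N TYPE('a) s N)"
  define K where "K = (1 + q) * unit_ball_vol (real DIM('a)) powr - q * real N * (real N + 1 + real N powr q)"
  define M where "M = real (N * N) * C + max 0 \<Lambda> * K"
  have bound: "\<delta> * X - \<epsilon> * Y - M * A powr - s \<le> max 0 \<Lambda> * E" if A: "0 < A" for A
  proof -
    obtain \<rho>' :: "'a \<Rightarrow> real" and l where \<rho>': "\<rho>' \<in> densities s N" "L_fun s \<rho>' = ennreal l" "L \<le> l"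
      "l \<le> L + E + (1 + q) * unit_ball_vol (real DIM('a)) powr - q * A powr - s * real N * (real N + 1 + real N powr q)"
      "ereal (D / 2 + \<delta> * X - W - \<epsilon> * Y - real (N * N) * (C * A powr - s)) \<le> G_N s N \<rho>'"
      unfolding q_def C_def \<delta>_def
      by (rule perturbed_density[OF k \<epsilon> r A X Y E(1) E(2)[unfolded \<delta>_def]])
    define g where "g = D / 2 + \<delta> * X - W - \<epsilon> * Y - real (N * N) * (C * A powr - s)"
    have l: "0 < l" using \<rho>'(3) L by simp
    have "ereal (g / l) = ereal g / enn2ereal (L_fun s \<rho>')"
      using l by (simp add: \<rho>'(2) enn2ereal_ennreal)
    also have "\<dots> \<le> G_N s N \<rho>' / enn2ereal (L_fun s \<rho>')"
      using \<rho>'(5) l by (intro ereal_divide_right_mono) (auto simp: g_def \<rho>'(2) enn2ereal_ennreal)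
    also have "\<dots> \<le> Lambda_N TYPE('a) s N"
      unfolding Lambda_N_def using \<rho>'(1) by (intro SUP_upper)
    finally have ge: "ereal (g / l) \<le> Lambda_N TYPE('a) s N" .
    \<comment> \<open>\<open>ge\<close> excludes minus infinity and \<open>le\<close> excludes plus
      infinity, so the supremum is a real number.\<close>
    then have \<Lambda>: "Lambda_N TYPE('a) s N = ereal \<Lambda>"
      using le unfolding \<Lambda>_def by (cases "Lambda_N TYPE('a) s N") auto
    have 1: "g \<le> \<Lambda> * l"
      using ge l by (simp add: \<Lambda> field_simps)
    have 2: "\<Lambda> * L \<le> D / 2 - W"
      using le L by (simp add: \<Lambda> field_simps)
    have "l - L \<le> E + K * A powr - s"
      using \<rho>'(4) by (simp add: K_def mult_ac)
    \<comment> \<open>The factor \<open>max 0 \<Lambda>\<close> gives an upper bound for either sign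
      of \<open>\<Lambda>\<close>, because \<open>l - L\<close> is nonnegative.\<close>
    then have "\<Lambda> * (l - L) \<le> max 0 \<Lambda> * (E + K * A powr - s)"
      using \<rho>'(3) by (intro mult_mono) auto
    with 1 2 have "g \<le> D / 2 - W + max 0 \<Lambda> * (E + K * A powr - s)"
      by (simp add: algebra_simps)
    then show ?thesis
      by (simp add: g_def M_def algebra_simps)
  qed
  have "((\<lambda>A. \<delta> * X - \<epsilon> * Y - M * A powr - s) \<longlongrightarrow> \<delta> * X - \<epsilon> * Y - M * 0) at_top"
    using s by (intro tendsto_intros tendsto_neg_powr filterlim_ident) auto
  moreover have "eventually (\<lambda>A. \<delta> * X - \<epsilon> * Y - M * A powr - s \<le> max 0 \<Lambda> * E) at_top"
    using eventually_gt_at_top[of 0] by eventually_elim (rule bound)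
  ultimately show ?thesis
    unfolding \<Lambda>_def by (intro tendsto_upperbound) auto
qed

end

section \<open>Interaction with a ball at distance R from the origin\<close>

lemma far_mass_tendsto_0:
  fixes \<rho> :: "'a::euclidean_space \<Rightarrow> real"
  assumes int: "integrable lborel \<rho>" and nonneg: "\<And>x. 0 \<le> \<rho> x" and \<eta>: "0 < \<eta>"
  obtains t :: "nat \<Rightarrow> real" where "t \<longlonglongrightarrow> 0" "\<And>n. 0 \<le> t n"
    "\<And>n. (\<integral>\<^sup>+x. ennreal (\<rho> x) * indicator {x. \<eta> * real n \<le> norm x} x \<partial>lborel) = ennreal (t n)"
proof
  have [measurable]: "\<rho> \<in> borel_measurable borel"
    using int by auto
  let ?f = "\<lambda>n x. \<rho> x * indicator {x. \<eta> * real n \<le> norm x} x"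
  have f: "integrable lborel (?f n)" for n
    using int nonneg by (intro Bochner_Integration.integrable_bound[OF int]) (auto simp: indicator_def)
  have "(\<lambda>n. \<integral>x. ?f n x \<partial>lborel) \<longlonglongrightarrow> (\<integral>x. 0 \<partial>(lborel :: 'a measure))"
  proof (rule integral_dominated_convergence[where w=\<rho>])
    show "AE x in lborel. (\<lambda>n. ?f n x) \<longlonglongrightarrow> 0"
    proof (rule AE_I2)
      fix x :: 'a
      obtain n0 where n0: "norm x / \<eta> < real n0"
        using reals_Archimedean2 by blast
      have "?f n x = 0" if "n \<ge> n0" for n
      proof -
        have "norm x / \<eta> < real n" using n0 that by linarith
        then show ?thesis using \<eta> by (simp add: field_simps)
      qed
      then show "(\<lambda>n. ?f n x) \<longlonglongrightarrow> 0"
        by (intro tendsto_eventually eventually_sequentiallyI)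
    qed
  qed (use int nonneg in \<open>auto simp: indicator_def\<close>)
  then show "(\<lambda>n. \<integral>x. ?f n x \<partial>lborel) \<longlonglongrightarrow> 0"
    by simp
  show "0 \<le> (\<integral>x. ?f n x \<partial>lborel)" for n
    using nonneg by (intro Bochner_Integration.integral_nonneg) auto
  show "(\<integral>\<^sup>+x. ennreal (\<rho> x) * indicator {x. \<eta> * real n \<le> norm x} x \<partial>lborel) =
      ennreal (\<integral>x. ?f n x \<partial>lborel)" for n
    using nonneg f by (subst nn_integral_eq_integral[symmetric])
      (auto simp: indicator_def intro!: nn_integral_cong)
qed

lemma norm_bounds_far_ball:
  fixes e x y :: "'a::euclidean_space"
  assumes "norm e = 1" "0 < R" "norm x < \<eta> * R" "y \<in> ball (R *\<^sub>R e) (\<eta> * R)"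
  shows "(1 - 2 * \<eta>) * R \<le> norm (x - y)" "norm (x - y) \<le> (1 + 2 * \<eta>) * R"
proof -
  have "norm (R *\<^sub>R e) = R" using assms by simp
  moreover have "norm (R *\<^sub>R e - y) < \<eta> * R"
    using assms by (simp add: dist_norm)
  ultimately show "(1 - 2 * \<eta>) * R \<le> norm (x - y)" "norm (x - y) \<le> (1 + 2 * \<eta>) * R"
    using assms norm_triangle_ineq4[of x y] norm_triangle_ineq4[of "R *\<^sub>R e" "R *\<^sub>R e - y"]
      norm_triangle_ineq[of "R *\<^sub>R e - y" "y"] norm_triangle_ineq[of "y - x" x] norm_minus_commute[of x y]
    by (auto simp: algebra_simps)
qed

text \<open>Only the mass \<open>m - t\<close> within \<open>\<eta> * R\<close> of the origin is
  counted; from there every point of the ball is at distance at most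
  \<open>(1 + 2 * \<eta>) * R\<close>.\<close>

lemma far_ball_interaction_ge:
  fixes \<rho> :: "'a::euclidean_space \<Rightarrow> real"
  assumes [measurable]: "\<rho> \<in> borel_measurable borel"
    and e: "norm e = 1" and R: "0 < R" and \<eta>: "0 < \<eta>" and s: "0 < s"
    and m: "(\<integral>\<^sup>+x. ennreal (\<rho> x) \<partial>lborel) = ennreal m"
    and t: "(\<integral>\<^sup>+x. ennreal (\<rho> x) * indicator {x. \<eta> * R \<le> norm x} x \<partial>lborel) = ennreal t" "0 \<le> t"
  shows "ennreal (((1 + 2 * \<eta>) * R) powr - s * (m - t)) \<le>
    (\<integral>\<^sup>+x. ennreal (\<rho> x) * (\<integral>\<^sup>+y. ennreal (uniform_ball (R *\<^sub>R e) (\<eta> * R) y) * riesz s x y \<partial>lborel) \<partial>lborel)"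
proof -
  let ?b = "((1 + 2 * \<eta>) * R) powr - s"
  have "(\<integral>\<^sup>+x. ennreal (\<rho> x) * indicator {x. norm x < \<eta> * R} x \<partial>lborel) + ennreal t = ennreal m"
    unfolding m[symmetric] t(1)[symmetric]
    by (subst nn_integral_add[symmetric]) (auto intro!: nn_integral_cong simp: indicator_def)
  then have near: "ennreal (m - t) = (\<integral>\<^sup>+x. ennreal (\<rho> x) * indicator {x. norm x < \<eta> * R} x \<partial>lborel)"
    using t(2) by (metis ennreal_add_diff_cancel_right ennreal_minus ennreal_neq_top)
  have "ennreal (?b * (m - t)) = ennreal (m - t) * ennreal ?b"
    by (subst mult.commute) (simp add: ennreal_mult'')
  also have "\<dots> = (\<integral>\<^sup>+x. ennreal (\<rho> x) * indicator {x. norm x < \<eta> * R} x * ennreal ?b \<partial>lborel)"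
    unfolding near by (subst nn_integral_multc) auto
  also have "\<dots> \<le> (\<integral>\<^sup>+x. ennreal (\<rho> x) * (\<integral>\<^sup>+y. ennreal (uniform_ball (R *\<^sub>R e) (\<eta> * R) y) * riesz s x y \<partial>lborel) \<partial>lborel)"
  proof (rule nn_integral_mono)
    fix x :: 'a
    show "ennreal (\<rho> x) * indicator {x. norm x < \<eta> * R} x * ennreal ?b \<le>
        ennreal (\<rho> x) * (\<integral>\<^sup>+y. ennreal (uniform_ball (R *\<^sub>R e) (\<eta> * R) y) * riesz s x y \<partial>lborel)"
    proof (cases "norm x < \<eta> * R")
      case True
      then have "ennreal ?b \<le> (\<integral>\<^sup>+y. ennreal (uniform_ball (R *\<^sub>R e) (\<eta> * R) y) * riesz s x y \<partial>lborel)"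
        using R \<eta> s e by (intro uniform_ball_potential_ge norm_bounds_far_ball) auto
      then show ?thesis
        using True by (simp add: mult_left_mono)
    qed simp
  qed
  finally show ?thesis .
qed

text \<open>Points within \<open>\<eta> * R\<close> of the origin are at least
  \<open>(1 - 2 * \<eta>) * R\<close> away from the ball. The others may lie in the ball itself, so
  for them the uniform bound on the potential is used. It has the same order in \<open>R\<close>,
  but it is multiplied by the tail mass \<open>t\<close> only.\<close>

lemma far_ball_interaction_le:
  fixes \<nu> :: "'a::euclidean_space measure" and s :: real
  defines "C \<equiv> 1 + 2 powr s / (1 - 2 powr (s - real DIM('a)))"
  assumes \<nu> [measurable_cong]: "sets \<nu> = sets borel"
    and e: "norm e = 1" and R: "0 < R" and \<eta>: "0 < \<eta>" "2 * \<eta> < 1" and s: "0 < s" "s < real DIM('a)"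
    and m: "emeasure \<nu> UNIV \<le> ennreal m" "0 \<le> m"
    and t: "emeasure \<nu> {x. \<eta> * R \<le> norm x} \<le> ennreal t" "0 \<le> t"
  shows "(\<integral>\<^sup>+x. (\<integral>\<^sup>+y. ennreal (uniform_ball (R *\<^sub>R e) (\<eta> * R) y) * riesz s x y \<partial>lborel) \<partial>\<nu>) \<le>
    ennreal (((1 - 2 * \<eta>) * R) powr - s * m + C * (\<eta> * R) powr - s * t)"
proof -
  let ?b = "((1 - 2 * \<eta>) * R) powr - s" and ?B = "C * (\<eta> * R) powr - s"
  have B: "0 \<le> ?B"
    using s by (auto simp: C_def powr_less_one less_imp_le
        intro!: mult_nonneg_nonneg add_nonneg_nonneg divide_nonneg_nonneg)
  have [measurable]: "{x. \<eta> * R \<le> norm x} \<in> sets borel" by measurable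
  have sp: "space \<nu> = UNIV" using sets_eq_imp_space_eq[OF \<nu>] by simp
  have "(\<integral>\<^sup>+x. (\<integral>\<^sup>+y. ennreal (uniform_ball (R *\<^sub>R e) (\<eta> * R) y) * riesz s x y \<partial>lborel) \<partial>\<nu>) \<le>
      (\<integral>\<^sup>+x. ennreal ?b + ennreal ?B * indicator {x. \<eta> * R \<le> norm x} x \<partial>\<nu>)"
  proof (rule nn_integral_mono)
    fix x :: 'a
    show "(\<integral>\<^sup>+y. ennreal (uniform_ball (R *\<^sub>R e) (\<eta> * R) y) * riesz s x y \<partial>lborel) \<le>
        ennreal ?b + ennreal ?B * indicator {x. \<eta> * R \<le> norm x} x"
    proof (cases "norm x < \<eta> * R")
      case True
      then have "(\<integral>\<^sup>+y. ennreal (uniform_ball (R *\<^sub>R e) (\<eta> * R) y) * riesz s x y \<partial>lborel) \<le> ennreal ?b"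
        using R \<eta> s e by (intro uniform_ball_potential_le_dist norm_bounds_far_ball) auto
      then show ?thesis
        using True by simp
    next
      case False
      have "(\<integral>\<^sup>+y. ennreal (uniform_ball (R *\<^sub>R e) (\<eta> * R) y) * riesz s x y \<partial>lborel) \<le> ennreal ?B"
        unfolding C_def using R \<eta> s by (intro uniform_ball_potential_le) auto
      then show ?thesis
        using False by (simp add: add_increasing)
    qed
  qed
  also have "\<dots> = ennreal ?b * emeasure \<nu> UNIV + ennreal ?B * emeasure \<nu> {x. \<eta> * R \<le> norm x}"
    by (subst nn_integral_add) (auto simp: nn_integral_cmult_indicator \<nu> sp)
  also have "\<dots> \<le> ennreal ?b * ennreal m + ennreal ?B * ennreal t"
    by (intro add_mono mult_left_mono m t) auto
  also have "\<dots> = ennreal (?b * m + ?B * t)"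
    using B m t by (simp add: ennreal_mult)
  finally show ?thesis .
qed

section \<open>Choice of the sector and passage to the limit\<close>

lemma occupied_sector_below_mean:
  assumes gc: "truncated_gc N \<Gamma>"
    and m: "m = prob_space.expectation (number_law N \<Gamma>) real"
    and var: "0 < prob_space.variance (number_law N \<Gamma>) real"
  obtains k where "k \<le> N" "0 < number_prob \<Gamma> k" "real k < m"
\<comment> \<open>If no occupied sector lay below the mean, the terms
  \<open>?p k * (real k - m)\<close> would be nonnegative with sum 0. They would all vanish, and the
  variance with them.\<close>
proof (rule ccontr)
  assume "\<not> thesis"
  with that have ge: "m \<le> real k" if "k \<le> N" "number_prob \<Gamma> k \<noteq> 0" for k
    using that number_prob_nonneg[OF gc, of k] by (meson leI less_eq_real_def not_le)
  let ?p = "number_prob \<Gamma>"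
  have m_eq: "m = (\<Sum>k\<le>N. ?p k * real k)"
    unfolding m by (rule expectation_number_law[OF gc])
  have "(\<Sum>k\<le>N. ?p k * (real k - m)) = (\<Sum>k\<le>N. ?p k * real k) - (\<Sum>k\<le>N. ?p k) * m"
    by (simp add: right_diff_distrib sum_subtractf sum_distrib_right)
  then have "(\<Sum>k\<le>N. ?p k * (real k - m)) = 0"
    by (simp add: sum_number_prob[OF gc] flip: m_eq)
  moreover have "0 \<le> ?p k * (real k - m)" if "k \<le> N" for k
    using ge[OF that] number_prob_nonneg[OF gc, of k] by (cases "?p k = 0") auto
  ultimately have "\<forall>k\<in>{..N}. ?p k * (real k - m) = 0"
    by (subst (asm) sum_nonneg_eq_0_iff) auto
  then have "(\<Sum>k\<le>N. ?p k * (real k - m)\<^sup>2) = 0"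
    by (intro sum.neutral) (auto simp: power2_eq_square)
  then show False
    using var by (simp add: expectation_number_law[OF gc] m)
qed

lemma gc_ratio_less_Lambda_N_of_nonneg:
  fixes s :: real and N :: nat and \<Gamma> :: "'a::euclidean_space grand_canonical" and \<rho> :: "'a \<Rightarrow> real"
  assumes s: "0 < s" "s < real DIM('a)"
    and gc: "truncated_gc N \<Gamma>"
    and int: "integrable lborel \<rho>" and nonneg: "\<And>x. 0 \<le> \<rho> x"
    and body: "gc_one_body N \<Gamma> = density lborel (\<lambda>x. ennreal (\<rho> x))"
    and finD: "D_fun s \<rho> < \<infinity>" and finW: "gc_W s N \<Gamma> < \<infinity>"
    and mean: "prob_space.expectation (number_law N \<Gamma>) real < real N"
    and var: "0 < prob_space.variance (number_law N \<Gamma>) real"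
    and Lpos: "0 < L_fun s \<rho>" and finL: "L_fun s \<rho> < \<infinity>"
  shows "gc_G s N \<Gamma> \<rho> / enn2ereal (L_fun s \<rho>) < Lambda_N TYPE('a) s N"
proof (rule ccontr)
  assume not_less: "\<not> ?thesis"
  have meas [measurable]: "\<rho> \<in> borel_measurable borel"
    using int by auto
  obtain D where D: "D_fun s \<rho> = ennreal D" "0 \<le> D"
    using finD by (cases "D_fun s \<rho>") auto
  obtain W where W: "gc_W s N \<Gamma> = ennreal W" "0 \<le> W"
    using finW by (cases "gc_W s N \<Gamma>") auto
  obtain L where L: "L_fun s \<rho> = ennreal L" "0 < L"
    using finL Lpos by (cases "L_fun s \<rho>") (auto simp: ennreal_eq_0_iff)
  have le: "Lambda_N TYPE('a) s N \<le> ereal ((D / 2 - W) / L)"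
    using not_less D W L by (simp add: gc_G_def enn2ereal_ennreal not_less)
  let ?p = "number_prob \<Gamma>"
  define m where "m = prob_space.expectation (number_law N \<Gamma>) real"
  have m_eq: "m = (\<Sum>k\<le>N. ?p k * real k)"
    unfolding m_def by (rule expectation_number_law[OF gc])
  have m0: "0 \<le> m"
    unfolding m_eq using number_prob_nonneg[OF gc] by (intro sum_nonneg) auto
  have mN: "m < real N" using mean by (simp add: m_def)
  obtain k where k: "k \<le> N" "0 < ?p k" "real k < m"
    using occupied_sector_below_mean[OF gc m_def var] by blast
  have kN: "k < N" using k mN by linarith
  define p where "p = ?p k"
  have p: "0 < p" using k by (simp add: p_def)
  define \<nu> where "\<nu> = one_body k (gc_sector \<Gamma> k)"
  \<comment> \<open>The tail of a single sector is thus controlled by the tail of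
    \<open>\<rho>\<close>, so one sequence \<open>t\<close> serves for both interaction
    bounds.\<close>
  have \<nu>_le: "emeasure \<nu> B \<le> (\<integral>\<^sup>+x. ennreal (\<rho> x) * indicator B x \<partial>lborel)" if "B \<in> sets borel" for B
  proof -
    have "emeasure \<nu> B \<le> emeasure (gc_one_body N \<Gamma>) B"
      unfolding emeasure_gc_one_body[OF gc that] \<nu>_def using k by (intro member_le_sum) auto
    then show ?thesis
      using that by (simp add: body emeasure_density)
  qed
  have \<nu>_total: "emeasure \<nu> UNIV = ennreal (real k * p)"
    unfolding \<nu>_def using k number_prob_nonneg[OF gc]
    by (simp add: emeasure_one_body_UNIV sets_gc_sector[OF gc] emeasure_space_gc_sector[OF gc] p_def
        ennreal_mult ennreal_of_nat_eq_real_of_nat)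
  have \<rho>_total: "(\<integral>\<^sup>+x. ennreal (\<rho> x) \<partial>lborel) = ennreal m"
  proof -
    have "(\<integral>\<^sup>+x. ennreal (\<rho> x) \<partial>lborel) = emeasure (gc_one_body N \<Gamma>) UNIV"
      by (simp add: body emeasure_density)
    also have "\<dots> = (\<Sum>k\<le>N. of_nat k * ennreal (?p k))"
      unfolding emeasure_gc_one_body[OF gc, of UNIV, simplified]
      by (intro sum.cong refl)
        (simp add: emeasure_one_body_UNIV sets_gc_sector[OF gc] emeasure_space_gc_sector[OF gc])
    also have "\<dots> = ennreal m"
      unfolding m_eq using number_prob_nonneg[OF gc]
      by (subst sum_ennreal[symmetric])
        (auto simp: ennreal_mult ennreal_of_nat_eq_real_of_nat mult.commute intro!: sum.cong)
    finally show ?thesis .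
  qed
  \<comment> \<open>At \<eta> = 0 the difference is \<open>m - real k > 0\<close>, so it stays
    positive for small \<eta>.\<close>
  have "((\<lambda>\<eta>. (1 + 2 * \<eta>) powr - s * m - (1 - 2 * \<eta>) powr - s * real k) \<longlongrightarrow>
      (1 + 2 * 0) powr - s * m - (1 - 2 * 0) powr - s * real k) (at_right 0)"
    by (intro tendsto_intros) auto
  then have "\<forall>\<^sub>F \<eta> in at_right 0. 0 < (1 + 2 * \<eta>) powr - s * m - (1 - 2 * \<eta>) powr - s * real k"
    by (rule order_tendstoD(1)) (use k in simp)
  \<comment> \<open>The bound 1/4 keeps \<open>1 - 2 * \<eta>\<close> positive and the distant ball
    outside the ball of radius \<eta> R around the origin.\<close>
  moreover have "\<forall>\<^sub>F \<eta> in at_right 0. 0 < \<eta> \<and> \<eta> < (1 / 4 :: real)"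
    by (auto simp: eventually_at_right_field intro!: exI[of _ "1/4"])
  ultimately obtain \<eta> where gap: "0 < (1 + 2 * \<eta>) powr - s * m - (1 - 2 * \<eta>) powr - s * real k"
    and \<eta>: "0 < \<eta>" "\<eta> < 1 / 4"
    using eventually_happens'[OF trivial_limit_at_right_real eventually_conj] by blast
  obtain e :: 'a where "e \<in> Basis" using nonempty_Basis by blast
  then have e: "norm e = 1" by simp
  obtain t :: "nat \<Rightarrow> real" where t: "t \<longlonglongrightarrow> 0" "\<And>n. 0 \<le> t n"
    "\<And>n. (\<integral>\<^sup>+x. ennreal (\<rho> x) * indicator {x. \<eta> * real n \<le> norm x} x \<partial>lborel) = ennreal (t n)"
    using far_mass_tendsto_0[OF int nonneg \<eta>(1)] by blast
  define C where "C = 1 + 2 powr s / (1 - 2 powr (s - real DIM('a)))"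
  have C: "0 \<le> C"
    using s by (auto simp: C_def powr_less_one less_imp_le intro!: add_nonneg_nonneg divide_nonneg_nonneg)
  define q where "q = s / real DIM('a)"
  have q: "0 < q" using s by (simp add: q_def)
  define \<Lambda> where "\<Lambda> = max 0 (real_of_ereal (Lambda_N TYPE('a) s N))"
  define \<kappa> where "\<kappa> = (1 + q) * unit_ball_vol (real DIM('a)) powr - q * \<eta> powr - s"
  have \<kappa>: "0 \<le> \<kappa>" using q by (simp add: \<kappa>_def)
  \<comment> \<open>This is \<open>perturbation_inequality\<close> with \<epsilon> = \<delta> / p,
    divided by the common factor \<delta> R^-s. In the bound for \<open>L_fun\<close> the parameter
    \<theta> is set to \<delta>, so that the powers of \<theta> and of the added mass coincide. The
    quotient by \<open>p\<close> remains because the tail of sector \<open>k\<close> is bounded by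
    the whole tail \<open>t n\<close>, without a factor \<open>p\<close>.\<close>
  have step: "(1 + 2 * \<eta>) powr - s * (m - t n) - (1 - 2 * \<eta>) powr - s * real k - C * \<eta> powr - s * t n / p
      \<le> \<Lambda> * (\<kappa> * (\<delta> powr (q - 1) * t n + 2 * \<delta> powr q))"
    if n: "0 < n" and \<delta>: "0 < \<delta>" "\<delta> \<le> p" for n \<delta>
  proof -
    let ?R = "real n" and ?\<epsilon> = "\<delta> / p"
    have R: "0 < ?R" using n by simp
    have \<delta>_eq: "?\<epsilon> * ?p k = \<delta>" using p by (simp add: p_def)
    have "ennreal (t n) \<le> ennreal m"
      unfolding t(3)[symmetric] \<rho>_total[symmetric] by (intro nn_integral_mono) (auto simp: indicator_def)
    then have tm: "t n \<le> m" using m0 by simp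
    let ?X = "((1 + 2 * \<eta>) * ?R) powr - s * (m - t n)"
    let ?Y = "((1 - 2 * \<eta>) * ?R) powr - s * (real k * p) + C * (\<eta> * ?R) powr - s * t n"
    let ?E = "(1 + q) * unit_ball_vol (real DIM('a)) powr - q * (\<eta> * ?R) powr - s * \<delta> *
      (\<delta> powr (q - 1) * t n + \<delta> powr q + \<delta> powr q)"
    have E0: "0 \<le> ?E"
      using q \<delta> t(2)[of n] by (intro mult_nonneg_nonneg add_nonneg_nonneg) auto
    have "?\<epsilon> * ?p k * ?X - ?\<epsilon> * ?Y \<le> \<Lambda> * ?E"
      unfolding \<Lambda>_def
    proof (rule perturbation_inequality[OF s gc meas nonneg body D W L le kN, where r="\<eta> * ?R" and c="?R *\<^sub>R e"])
      show "ennreal ?X \<le> (\<integral>\<^sup>+x. ennreal (\<rho> x) * (\<integral>\<^sup>+y. ennreal (uniform_ball (?R *\<^sub>R e) (\<eta> * ?R) y) *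
          riesz s x y \<partial>lborel) \<partial>lborel)"
        by (rule far_ball_interaction_ge[OF meas e R \<eta>(1) s(1) \<rho>_total t(3) t(2)])
      show "(\<integral>\<^sup>+x. (\<integral>\<^sup>+y. ennreal (uniform_ball (?R *\<^sub>R e) (\<eta> * ?R) y) * riesz s x y \<partial>lborel)
          \<partial>one_body k (gc_sector \<Gamma> k)) \<le> ennreal ?Y"
        unfolding \<nu>_def[symmetric] C_def
      proof (rule far_ball_interaction_le)
        show "emeasure \<nu> {x. \<eta> * ?R \<le> norm x} \<le> ennreal (t n)"
          unfolding t(3)[symmetric] by (rule \<nu>_le) measurable
      qed (use R \<eta> s e t p \<nu>_total in \<open>auto simp: \<nu>_def\<close>)
      have "L_fun s (\<lambda>x. \<rho> x + \<delta> * uniform_ball (?R *\<^sub>R e) (\<eta> * ?R) x) \<le> L_fun s \<rho> + ennreal ?E"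
        unfolding q_def
      proof (rule L_fun_add_uniform_ball_le[OF meas nonneg])
        have far: "\<eta> * ?R \<le> norm x" if "x \<in> ball (?R *\<^sub>R e) (\<eta> * ?R)" for x
        proof -
          have "2 * \<eta> * ?R \<le> 1 * ?R"
            using \<eta> R by (intro mult_right_mono) auto
          moreover have "norm (?R *\<^sub>R e - x) < \<eta> * ?R"
            using that by (simp add: dist_norm)
          moreover have "?R \<le> norm (?R *\<^sub>R e - x) + norm x"
            using norm_triangle_ineq[of "?R *\<^sub>R e - x" x] e by simp
          ultimately show ?thesis by linarith
        qed
        show "(\<integral>\<^sup>+x. ennreal (\<rho> x) * indicator (ball (?R *\<^sub>R e) (\<eta> * ?R)) x \<partial>lborel) \<le> ennreal (t n)"
          unfolding t(3)[symmetric] using far by (intro nn_integral_mono mult_left_mono) (auto simp: indicator_def)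
      qed (use s \<delta> \<eta> R t in auto)
      then show "L_fun s (\<lambda>x. \<rho> x + ?\<epsilon> * ?p k * uniform_ball (?R *\<^sub>R e) (\<eta> * ?R) x) \<le> ennreal (L + ?E)"
        using L E0 unfolding \<delta>_eq by simp
      show "0 \<le> ?X" using tm by simp
      show "0 \<le> ?Y" using C t p by (intro add_nonneg_nonneg mult_nonneg_nonneg) auto
    qed (use E0 R \<eta> \<delta> p in auto)
    then have "\<delta> * ?X - \<delta> / p * ?Y \<le> \<Lambda> * ?E"
      by (simp only: \<delta>_eq)
    moreover have "\<delta> * ?X - \<delta> / p * ?Y = \<delta> * ?R powr - s *
        ((1 + 2 * \<eta>) powr - s * (m - t n) - (1 - 2 * \<eta>) powr - s * real k - C * \<eta> powr - s * t n / p)"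
    proof -
      have "((1 + 2 * \<eta>) * ?R) powr - s = (1 + 2 * \<eta>) powr - s * ?R powr - s"
        "((1 - 2 * \<eta>) * ?R) powr - s = (1 - 2 * \<eta>) powr - s * ?R powr - s"
        "(\<eta> * ?R) powr - s = \<eta> powr - s * ?R powr - s"
        using \<eta> R by (auto intro!: powr_mult)
      then show ?thesis
        using p by (simp only:) (simp add: field_simps)
    qed
    moreover have "\<Lambda> * ?E = \<delta> * ?R powr - s * (\<Lambda> * (\<kappa> * (\<delta> powr (q - 1) * t n + 2 * \<delta> powr q)))"
      using \<eta> R by (simp add: powr_mult \<kappa>_def mult_ac)
    moreover have "0 < \<delta> * ?R powr - s" using \<delta> R by simp
    ultimately show ?thesis
      by (metis mult_le_cancel_left_pos)
  qed
  \<comment> \<open>Here \<delta> must stay fixed: the coefficient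
    \<open>\<delta> powr (q - 1)\<close> of \<open>t n\<close> is unbounded as \<delta> tends to
    0.\<close>
  have limit: "(1 + 2 * \<eta>) powr - s * m - (1 - 2 * \<eta>) powr - s * real k \<le> \<Lambda> * (\<kappa> * (2 * \<delta> powr q))"
    if \<delta>: "0 < \<delta>" "\<delta> \<le> p" for \<delta>
  proof (rule tendsto_le[OF trivial_limit_sequentially])
    show "(\<lambda>n. \<Lambda> * (\<kappa> * (\<delta> powr (q - 1) * t n + 2 * \<delta> powr q))) \<longlonglongrightarrow> \<Lambda> * (\<kappa> * (2 * \<delta> powr q))"
      using t(1) by (auto intro!: tendsto_eq_intros)
    show "(\<lambda>n. (1 + 2 * \<eta>) powr - s * (m - t n) - (1 - 2 * \<eta>) powr - s * real k - C * \<eta> powr - s * t n / p)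
        \<longlonglongrightarrow> (1 + 2 * \<eta>) powr - s * m - (1 - 2 * \<eta>) powr - s * real k"
      using t(1) p by (auto intro!: tendsto_eq_intros)
    show "\<forall>\<^sub>F n in sequentially. (1 + 2 * \<eta>) powr - s * (m - t n) - (1 - 2 * \<eta>) powr - s * real k -
        C * \<eta> powr - s * t n / p \<le> \<Lambda> * (\<kappa> * (\<delta> powr (q - 1) * t n + 2 * \<delta> powr q))"
      using eventually_gt_at_top[of 0] by eventually_elim (rule step[OF _ \<delta>])
  qed
  \<comment> \<open>The surviving cost carries \<open>\<delta> powr q\<close> with
    \<open>q > 0\<close>, while the left-hand side of \<open>limit\<close> is the positive constant
    from \<open>gap\<close>.\<close>
  have "((\<lambda>\<delta>. \<Lambda> * (\<kappa> * (2 * \<delta> powr q))) \<longlongrightarrow> \<Lambda> * (\<kappa> * (2 * 0 powr q))) (at_right 0)"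
  proof (intro tendsto_intros tendsto_powr')
    have "\<forall>\<^sub>F \<delta> in at_right 0. 0 \<le> (\<delta> :: real)"
      using eventually_at_right_less[of 0] by eventually_elim simp
    then show "0 \<noteq> (0::real) \<or> 0 < q \<and> (\<forall>\<^sub>F \<delta> in at_right 0. 0 \<le> (\<delta> :: real))"
      using q by simp
  qed
  moreover have "\<forall>\<^sub>F \<delta> in at_right 0. (1 + 2 * \<eta>) powr - s * m - (1 - 2 * \<eta>) powr - s * real k
      \<le> \<Lambda> * (\<kappa> * (2 * \<delta> powr q))"
    using p limit by (auto simp: eventually_at_right_field intro!: exI[of _ p])
  ultimately have "(1 + 2 * \<eta>) powr - s * m - (1 - 2 * \<eta>) powr - s * real k \<le> \<Lambda> * (\<kappa> * (2 * 0 powr q))"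
    by (intro tendsto_lowerbound) auto
  then show False
    using gap by simp
qed

theorem proposition4p3:
  fixes s :: real and N :: nat
    and \<Gamma> :: "'a::euclidean_space grand_canonical" and \<rho> :: "'a \<Rightarrow> real"
  assumes "0 < s" and "s < real DIM('a)" and "1 \<le> N"
    and "truncated_gc N \<Gamma>"
    and "\<rho> \<in> nonneg_L1_Lp s"
    and "gc_one_body N \<Gamma> = density lborel (\<lambda>x. ennreal (\<rho> x))"
    and "D_fun s \<rho> < \<infinity>" and "gc_W s N \<Gamma> < \<infinity>"
    and "0 < prob_space.expectation (number_law N \<Gamma>) real"
    and "prob_space.expectation (number_law N \<Gamma>) real < real N"
    and "0 < prob_space.variance (number_law N \<Gamma>) real"
    and "0 < L_fun s \<rho>" and "L_fun s \<rho> < \<infinity>"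
  shows "gc_G s N \<Gamma> \<rho> / enn2ereal (L_fun s \<rho>) < Lambda_N TYPE('a) s N"
proof -
  \<comment> \<open>The density is nonnegative only almost everywhere. Taking the positive part
    leaves \<open>ennreal (\<rho> x)\<close> unchanged at every point, because
    \<open>ennreal\<close> maps negative reals to 0. In \<open>L_fun\<close> the power is formed
    before \<open>ennreal\<close> is applied, so there the two integrands are compared almost
    everywhere.\<close>
  define \<rho>' where "\<rho>' x = max 0 (\<rho> x)" for x
  have \<rho>: "integrable lborel \<rho>" "AE x in lborel. 0 \<le> \<rho> x"
    using assms(5) by (auto simp: nonneg_L1_Lp_def)
  have eq: "ennreal (\<rho>' x) = ennreal (\<rho> x)" for x
    by (simp add: \<rho>'_def max_def ennreal_neg)
  have D: "D_fun s \<rho>' = D_fun s \<rho>"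
    by (simp add: D_fun_def eq)
  have L: "L_fun s \<rho>' = L_fun s \<rho>"
    unfolding L_fun_def using \<rho>(2) by (intro nn_integral_cong_AE) (auto simp: \<rho>'_def max_def)
  have "gc_G s N \<Gamma> \<rho>' / enn2ereal (L_fun s \<rho>') < Lambda_N TYPE('a) s N"
  proof (rule gc_ratio_less_Lambda_N_of_nonneg)
    show "integrable lborel \<rho>'"
      unfolding \<rho>'_def[abs_def] using \<rho>(1) by (intro Bochner_Integration.integrable_max) auto
    show "gc_one_body N \<Gamma> = density lborel (\<lambda>x. ennreal (\<rho>' x))"
      by (simp add: eq assms)
  qed (use assms D L in \<open>auto simp: \<rho>'_def\<close>)
  then show ?thesis
    by (simp add: gc_G_def D L)
qed

end
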